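(* Let $\mathbb{F}_q$ be a finite field with $q$ elements, let $a,b\in\mathbb{F}_q^{\times}$, and write $t:=q^{-s}$. For the Lie algebras over $\mathbb{F}_q$ defined in the context (where for $M_a^9(\mathbb{F}_q)$ it is assumed that $x^2-x-a$ has no roots in $\mathbb{F}_q$), the ideal zeta functions are \begin{align*} \zeta_{M^{1}(\mathbb{F}_q)}^{\triangleleft}(s)&=1+(1+q+q^2+q^3)t+(1+q+q^2)(1+q^2)t^2+(1+q+q^2+q^3)t^3+t^4,\\ \zeta_{M^{2}(\mathbb{F}_q)}^{\triangleleft}(s)&=1+t+(1+q+q^2)t^2+(1+q+q^2)t^3+t^4,\\ \zeta_{M_a^3(\mathbb{F}_q)}^{\triangleleft}(s)&=1+t+(2+q)t^2+(2+q)t^3+t^4\quad(a\neq1),\\ \zeta_{M_1^3(\mathbb{F}_q)}^{\triangleleft}(s)&=1+t+(1+q)t^2+(1+q)t^3+t^4,\\ \zeta_{M_0^{3}(\mathbb{F}_q)}^{\triangleleft}(s)&=1+(1+q)t+(2+q)t^2+(2+q)t^3+t^4,\\ \zeta_{M^{4}(\mathbb{F}_q)}^{\triangleleft}(s)&=1+(1+q+q^2)t+(2+q+q^2)t^2+(2+q)t^3+t^4,\\ \zeta_{M^{5}(\mathbb{F}_q)}^{\triangleleft}(s)&=1+(1+q+q^2)t+(1+q+q^2)t^2+(1+q)t^3+t^4,\\ \zeta_{M_{a,b}^{6}(\mathbb{F}_q)}^{\triangleleft}(s)&=1+t+|V_{6,a,b}^{(2)}(\mathbb{F}_q)|t^2+|V_{6,a,b}^{(1)}(\mathbb{F}_q)|t^3+t^4,\\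 \zeta_{M_{a,0}^{6}(\mathbb{F}_q)}^{\triangleleft}(s)&=1+t+|V_{6,a,0}^{(2)}(\mathbb{F}_q)|t^2+|V_{6,a,0}^{(1)}(\mathbb{F}_q)|t^3+t^4,\\ \zeta_{M_{0,b}^{6}(\mathbb{F}_q)}^{\triangleleft}(s)&=1+(1+q)t+(1+|V_{3,b}(\mathbb{F}_q)|)t^2+(1+|V_{3,b}(\mathbb{F}_q)|)t^3+t^4,\\ \zeta_{M_{0,0}^{6}(\mathbb{F}_q)}^{\triangleleft}(s)&=1+(1+q)t+2t^2+2t^3+t^4,\\ \zeta_{M_{a,b}^{7}(\mathbb{F}_q)}^{\triangleleft}(s)&=1+t+|V_{7,a,b}^{(2)}(\mathbb{F}_q)|t^2+|V_{7,a,b}^{(1)}(\mathbb{F}_q)|t^3+t^4,\\ \zeta_{M_{a,0}^{7}(\mathbb{F}_q)}^{\triangleleft}(s)&=1+t+|V_{7,a,0}^{(2)}(\mathbb{F}_q)|t^2+|V_{7,a,0}^{(1)}(\mathbb{F}_q)|t^3+t^4,\\ \zeta_{M_{0,b}^{7}(\mathbb{F}_q)}^{\triangleleft}(s)&=1+(1+q)t+(1+|V_{4,b}(\mathbb{F}_q)|)t^2+(1+|V_{4,b}(\mathbb{F}_q)|)t^3+t^4,\\ \zeta_{M_{0,0}^{7}(\mathbb{F}_q)}^{\triangleleft}(s)&=1+(1+q)t+t^2+t^3+t^4,\\ \zeta_{M^{8}(\mathbb{F}_q)}^{\triangleleft}(s)&=1+(1+q)t+3t^2+2t^3+t^4,\\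 \zeta_{M_{a}^{9}(\mathbb{F}_q)}^{\triangleleft}(s)&=1+(1+q)t+t^2+t^4,\\ \zeta_{M^{12}(\mathbb{F}_q)}^{\triangleleft}(s)&=1+t+(1+q)t^2+t^3+t^4,\\ \zeta_{M_{a}^{13}(\mathbb{F}_q)}^{\triangleleft}(s)&=1+t+|V_{13,a}(\mathbb{F}_q)|t^2+t^3+t^4,\\ \zeta_{M_{0}^{13}(\mathbb{F}_q)}^{\triangleleft}(s)&=1+(1+q)t+2t^2+t^3+t^4,\\ \zeta_{M_{a}^{14}(\mathbb{F}_q)}^{\triangleleft}(s)&=1+t+|V_{14,a}(\mathbb{F}_q)|t^2+t^3+t^4. \end{align*}
   Context: For a Lie algebra $L$ over $\mathbb{F}_q$ of finite dimension $n$, the ideal zeta function is $\zeta_L^{\triangleleft}(s)=\sum_{i=0}^{n}a^{\triangleleft}_{q^i}(L)\,t^{i}$, where $t=q^{-s}$ and $a^{\triangleleft}_{q^i}(L)$ is the number of ideals of $L$ of codimension $i$ (index $q^i$). All Lie algebras below are 4-dimensional over $\mathbb{F}_q$ with basis $e_1,e_2,e_3,e_4$; up to antisymmetry all brackets of basis elements that are not listed are zero. Parameters $a,b$ lie in $\mathbb{F}_q$. - $M^1$: abelian. - $M^2$: $[e_4,e_1]=e_1$, $[e_4,e_2]=e_2$, $[e_4,e_3]=e_3$. - $M_a^3$: $[e_4,e_1]=e_1$, $[e_4,e_2]=e_3$, $[e_4,e_3]=-ae_2+(a+1)e_3$. - $M^4$: $[e_4,e_2]=e_3$, $[e_4,e_3]=e_3$.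 - $M^5$: $[e_4,e_2]=e_3$. - $M_{a,b}^6$: $[e_4,e_1]=e_2$, $[e_4,e_2]=e_3$, $[e_4,e_3]=ae_1+be_2+e_3$. - $M_{a,b}^7$: $[e_4,e_1]=e_2$, $[e_4,e_2]=e_3$, $[e_4,e_3]=ae_1+be_2$. - $M^8$: $[e_1,e_2]=e_2$, $[e_3,e_4]=e_4$. - $M_a^9$ (defined only for $a$ such that $x^2-x-a$ has no roots in $\mathbb{F}_q$): $[e_4,e_1]=e_1+ae_2$, $[e_4,e_2]=e_1$, $[e_3,e_1]=e_1$, $[e_3,e_2]=e_2$. - $M^{12}$: $[e_4,e_1]=e_1$, $[e_4,e_2]=2e_2$, $[e_4,e_3]=e_3$, $[e_3,e_1]=e_2$. - $M_a^{13}$: $[e_4,e_1]=e_1+ae_3$, $[e_4,e_2]=e_2$, $[e_4,e_3]=e_1$, $[e_3,e_1]=e_2$. - $M_a^{14}$: $[e_4,e_1]=ae_3$, $[e_4,e_3]=e_1$, $[e_3,e_1]=e_2$. The point counts are: $|V_{3,a}(\mathbb{F}_q)|=|\{x\in\mathbb{F}_q:ax^2-x-1=0\}|$, $|V_{4,a}(\mathbb{F}_q)|=|\{x\in\mathbb{F}_q:ax^2-1=0\}|$, $|V_{6,a,b}^{(1)}(\mathbb{F}_q)|=|\{x\in\mathbb{F}_q:-a^2x^3+ax^2+bx+1=0\}|$, $|V_{6,a,b}^{(2)}(\mathbb{F}_q)|=|\{x\in\mathbb{F}_q:ax^3-bx^2+x+1=0\}|$, $|V_{7,a,b}^{(1)}(\mathbb{F}_q)|=|\{x\in\mathbb{F}_q:a^2x^3-bx-1=0\}|$,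 $|V_{7,a,b}^{(2)}(\mathbb{F}_q)|=|\{x\in\mathbb{F}_q:ax^3-bx^2+1=0\}|$, $|V_{13,a}(\mathbb{F}_q)|=|\{x\in\mathbb{F}_q:x^2+x-a=0\}|$, $|V_{14,a}(\mathbb{F}_q)|=|\{x\in\mathbb{F}_q:x^2-a=0\}|$. *)

theory Defs
  imports "HOL-Analysis.Analysis"
begin

locale lie_algebra =
  fixes br :: "'k::field ^ 'n \<Rightarrow> 'k ^ 'n \<Rightarrow> 'k ^ 'n"
  assumes add_left: "br (x + y) z = br x z + br y z"
    and scale_left: "br (c *s x) z = c *s br x z"
    and add_right: "br x (y + z) = br x y + br x z"
    and scale_right: "br x (c *s z) = c *s br x z"
    and alternating: "br x x = 0"
    and jacobi: "br x (br y z) + br y (br z x) + br z (br x y) = 0"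

definition lie_ideal :: "('k::field ^ 'n \<Rightarrow> 'k ^ 'n \<Rightarrow> 'k ^ 'n) \<Rightarrow> ('k ^ 'n) set \<Rightarrow> bool" where
  "lie_ideal br I \<longleftrightarrow> vec.subspace I \<and> (\<forall>x. \<forall>y\<in>I. br x y \<in> I)"

definition num_ideals :: "('k::{field,finite} ^ 'n \<Rightarrow> 'k ^ 'n \<Rightarrow> 'k ^ 'n) \<Rightarrow> nat \<Rightarrow> nat" where
  "num_ideals br i = card {I. lie_ideal br I \<and> vec.dim I + i = CARD('n)}"

definition ideal_zeta ::
  "('k::{field,finite} ^ 'n \<Rightarrow> 'k ^ 'n \<Rightarrow> 'k ^ 'n) \<Rightarrow> complex \<Rightarrow> complex" where
  "ideal_zeta br s =
     (\<Sum>i\<le>CARD('n). of_nat (num_ideals br i) * (of_nat CARD('k) powr (- s)) ^ i)"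

text \<open>The bracket is given by a list of triples \<open>(i, j, v)\<close>, each standing for
  \<open>[e\<^sub>i, e\<^sub>j] = v\<close>. If every unordered pair \<open>{i, j}\<close> occurs at most once, with \<open>i \<noteq> j\<close>,
  then \<open>bracket_of rs\<close> is the unique alternating bilinear map with the listed values
  for which every other bracket of two basis vectors vanishes up to antisymmetry.\<close>

definition bracket_of :: "('n \<times> 'n \<times> ('k::field ^ 'n)) list \<Rightarrow> 'k ^ 'n \<Rightarrow> 'k ^ 'n \<Rightarrow> 'k ^ 'n" where
  "bracket_of rs x y = (\<Sum>(i, j, v)\<leftarrow>rs. (x $ i * y $ j - x $ j * y $ i) *s v)"

text \<open>In the four-element index type \<^typ>\<open>4\<close> the numeral \<open>4\<close> equals \<open>0\<close>, so \<open>1, 2, 3, 4\<close>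
  are its four distinct elements.\<close>

abbreviation e :: "4 \<Rightarrow> 'k::field ^ 4" where
  "e i \<equiv> axis i 1"

definition M1 :: "'k::field ^ 4 \<Rightarrow> 'k ^ 4 \<Rightarrow> 'k ^ 4" where
  "M1 = bracket_of []"

definition M2 :: "'k::field ^ 4 \<Rightarrow> 'k ^ 4 \<Rightarrow> 'k ^ 4" where
  "M2 = bracket_of [(4, 1, e 1), (4, 2, e 2), (4, 3, e 3)]"

definition M3 :: "'k::field \<Rightarrow> 'k ^ 4 \<Rightarrow> 'k ^ 4 \<Rightarrow> 'k ^ 4" where
  "M3 a = bracket_of [(4, 1, e 1), (4, 2, e 3), (4, 3, (- a) *s e 2 + (a + 1) *s e 3)]"

definition M4 :: "'k::field ^ 4 \<Rightarrow> 'k ^ 4 \<Rightarrow> 'k ^ 4" where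
  "M4 = bracket_of [(4, 2, e 3), (4, 3, e 3)]"

definition M5 :: "'k::field ^ 4 \<Rightarrow> 'k ^ 4 \<Rightarrow> 'k ^ 4" where
  "M5 = bracket_of [(4, 2, e 3)]"

definition M6 :: "'k::field \<Rightarrow> 'k \<Rightarrow> 'k ^ 4 \<Rightarrow> 'k ^ 4 \<Rightarrow> 'k ^ 4" where
  "M6 a b = bracket_of [(4, 1, e 2), (4, 2, e 3), (4, 3, a *s e 1 + b *s e 2 + e 3)]"

definition M7 :: "'k::field \<Rightarrow> 'k \<Rightarrow> 'k ^ 4 \<Rightarrow> 'k ^ 4 \<Rightarrow> 'k ^ 4" where
  "M7 a b = bracket_of [(4, 1, e 2), (4, 2, e 3), (4, 3, a *s e 1 + b *s e 2)]"

definition M8 :: "'k::field ^ 4 \<Rightarrow> 'k ^ 4 \<Rightarrow> 'k ^ 4" where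
  "M8 = bracket_of [(1, 2, e 2), (3, 4, e 4)]"

definition M9 :: "'k::field \<Rightarrow> 'k ^ 4 \<Rightarrow> 'k ^ 4 \<Rightarrow> 'k ^ 4" where
  "M9 a = bracket_of [(4, 1, e 1 + a *s e 2), (4, 2, e 1), (3, 1, e 1), (3, 2, e 2)]"

definition M12 :: "'k::field ^ 4 \<Rightarrow> 'k ^ 4 \<Rightarrow> 'k ^ 4" where
  "M12 = bracket_of [(4, 1, e 1), (4, 2, 2 *s e 2), (4, 3, e 3), (3, 1, e 2)]"

definition M13 :: "'k::field \<Rightarrow> 'k ^ 4 \<Rightarrow> 'k ^ 4 \<Rightarrow> 'k ^ 4" where
  "M13 a = bracket_of [(4, 1, e 1 + a *s e 3), (4, 2, e 2), (4, 3, e 1), (3, 1, e 2)]"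

definition M14 :: "'k::field \<Rightarrow> 'k ^ 4 \<Rightarrow> 'k ^ 4 \<Rightarrow> 'k ^ 4" where
  "M14 a = bracket_of [(4, 1, a *s e 3), (4, 3, e 1), (3, 1, e 2)]"

definition V3 :: "'k::field \<Rightarrow> 'k set" where
  "V3 a = {x. a * x^2 - x - 1 = 0}"

definition V4 :: "'k::field \<Rightarrow> 'k set" where
  "V4 a = {x. a * x^2 - 1 = 0}"

definition V6_1 :: "'k::field \<Rightarrow> 'k \<Rightarrow> 'k set" where
  "V6_1 a b = {x. - (a^2) * x^3 + a * x^2 + b * x + 1 = 0}"

definition V6_2 :: "'k::field \<Rightarrow> 'k \<Rightarrow> 'k set" where
  "V6_2 a b = {x. a * x^3 - b * x^2 + x + 1 = 0}"

definition V7_1 :: "'k::field \<Rightarrow> 'k \<Rightarrow> 'k set" where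
  "V7_1 a b = {x. a^2 * x^3 - b * x - 1 = 0}"

definition V7_2 :: "'k::field \<Rightarrow> 'k \<Rightarrow> 'k set" where
  "V7_2 a b = {x. a * x^3 - b * x^2 + 1 = 0}"

definition V13 :: "'k::field \<Rightarrow> 'k set" where
  "V13 a = {x. x^2 + x - a = 0}"

definition V14 :: "'k::field \<Rightarrow> 'k set" where
  "V14 a = {x. x^2 - a = 0}"

lemma bracket_of_basis:
  fixes rs :: "('n::finite \<times> 'n \<times> ('k::field ^ 'n)) list"
  assumes "distinct (map (\<lambda>(i, j, v). {i, j}) rs)" and "\<forall>(i, j, v)\<in>set rs. i \<noteq> j"
  shows "(i, j, v) \<in> set rs \<Longrightarrow> bracket_of rs (axis i 1) (axis j 1) = v"
    and "(\<And>v. (i, j, v) \<notin> set rs \<and> (j, i, v) \<notin> set rs) \<Longrightarrow>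
      bracket_of rs (axis i 1) (axis j 1) = 0"
proof -
  have zero: "bracket_of rs (axis i 1) (axis j 1) = 0"
    if "\<forall>v. (i, j, v) \<notin> set rs \<and> (j, i, v) \<notin> set rs"
    for rs :: "('n \<times> 'n \<times> ('k ^ 'n)) list"
    using that
    by (induction rs) (auto simp: bracket_of_def axis_def)
  show "bracket_of rs (axis i 1) (axis j 1) = 0"
    if "\<And>v. (i, j, v) \<notin> set rs \<and> (j, i, v) \<notin> set rs"
    using zero that by blast
  show "bracket_of rs (axis i 1) (axis j 1) = v" if "(i, j, v) \<in> set rs"
    using assms that
  proof (induction rs)
    case Nil
    then show ?case by simp
  next
    case (Cons r rs)
    obtain i' j' v' where r: "r = (i', j', v')" by (cases r) auto
    have fresh: "(i', j', w) \<notin> set rs \<and> (j', i', w) \<notin> set rs" for w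
    proof -
      have "{i', j'} \<notin> (\<lambda>(i, j, v). {i, j}) ` set rs"
        using Cons.prems(1) by (simp add: r)
      moreover have "{i', j'} \<in> (\<lambda>(i, j, v). {i, j}) ` set rs" if "(i', j', w) \<in> set rs"
        using that by (rule rev_image_eqI) simp
      moreover have "{i', j'} \<in> (\<lambda>(i, j, v). {i, j}) ` set rs" if "(j', i', w) \<in> set rs"
        using that by (rule rev_image_eqI) (simp add: insert_commute)
      ultimately show ?thesis by blast
    qed
    have step: "bracket_of (r # rs) (axis i 1) (axis j 1) =
        ((axis i 1 :: 'k ^ 'n) $ i' * (axis j 1 :: 'k ^ 'n) $ j'
          - (axis i 1 :: 'k ^ 'n) $ j' * (axis j 1 :: 'k ^ 'n) $ i') *s v'
        + bracket_of rs (axis i 1) (axis j 1)"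
      by (simp add: bracket_of_def r)
    show ?case
    proof (cases "(i, j, v) = r")
      case True
      then have "\<forall>w. (i, j, w) \<notin> set rs \<and> (j, i, w) \<notin> set rs"
        using fresh by (simp add: r)
      then have "bracket_of rs (axis i 1) (axis j 1) = 0"
        by (rule zero)
      then show ?thesis
        unfolding step using True Cons.prems(2) by (simp add: r axis_def)
    next
      case False
      then have mem: "(i, j, v) \<in> set rs" using Cons.prems(3) by auto
      then have "\<not> (i = i' \<and> j = j')" and "\<not> (i = j' \<and> j = i')"
        using fresh by metis+
      then have "(axis i 1 :: 'k ^ 'n) $ i' * (axis j 1 :: 'k ^ 'n) $ j'
          - (axis i 1 :: 'k ^ 'n) $ j' * (axis j 1 :: 'k ^ 'n) $ i' = 0"
        by (auto simp: axis_def)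
      moreover have "bracket_of rs (axis i 1) (axis j 1) = v"
        using Cons.IH Cons.prems mem by simp
      ultimately show ?thesis by (simp add: step)
    qed
  qed
qed

lemma lie_algebra_bracket_of:
  fixes rs :: "('n::finite \<times> 'n \<times> ('k::field ^ 'n)) list"
  assumes "\<And>x y z. bracket_of rs x (bracket_of rs y z) + bracket_of rs y (bracket_of rs z x)
    + bracket_of rs z (bracket_of rs x y) = 0"
  shows "lie_algebra (bracket_of rs)"
proof
  fix x y z :: "'k ^ 'n" and c :: 'k
  show "bracket_of rs (x + y) z = bracket_of rs x z + bracket_of rs y z"
    unfolding bracket_of_def
    by (induction rs) (auto simp: vec_eq_iff algebra_simps)
  show "bracket_of rs x (y + z) = bracket_of rs x y + bracket_of rs x z"
    unfolding bracket_of_def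
    by (induction rs) (auto simp: vec_eq_iff algebra_simps)
  show "bracket_of rs (c *s x) z = c *s bracket_of rs x z"
    unfolding bracket_of_def
    by (induction rs) (auto simp: vec_eq_iff algebra_simps)
  show "bracket_of rs x (c *s z) = c *s bracket_of rs x z"
    unfolding bracket_of_def
    by (induction rs) (auto simp: vec_eq_iff algebra_simps)
  show "bracket_of rs x x = 0"
    unfolding bracket_of_def
    by (induction rs) (auto simp: vec_eq_iff algebra_simps)
qed (fact assms)

lemma lie_algebra_M:
  fixes a b :: "'k::field"
  shows "lie_algebra (M1 :: 'k ^ 4 \<Rightarrow> _)" "lie_algebra (M2 :: 'k ^ 4 \<Rightarrow> _)"
    "lie_algebra (M3 a)" "lie_algebra (M4 :: 'k ^ 4 \<Rightarrow> _)" "lie_algebra (M5 :: 'k ^ 4 \<Rightarrow> _)"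
    "lie_algebra (M6 a b)" "lie_algebra (M7 a b)" "lie_algebra (M8 :: 'k ^ 4 \<Rightarrow> _)"
    "lie_algebra (M9 a)" "lie_algebra (M12 :: 'k ^ 4 \<Rightarrow> _)" "lie_algebra (M13 a)"
    "lie_algebra (M14 a)"
  unfolding M1_def M2_def M3_def M4_def M5_def M6_def M7_def M8_def M9_def M12_def M13_def M14_def
  by (rule lie_algebra_bracket_of,
      simp add: bracket_of_def vec_eq_iff forall_4 axis_def algebra_simps)+

end

(* Subspaces of K^4 are put into reduced row echelon form, so that each cell of lines and planes is
   parametrised bijectively by free entries; hyperplanes are kernels of normalised functionals.
   A subspace is an ideal iff it is stable under bracketing with the four basis vectors, which in
   each cell is a system of polynomial equations in the free entries, and a hyperplane is an ideal
   iff its functional kills all brackets.  In the nonlinear cells of M^6, M^7, M^13 and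
   M^14 all but one entry can be eliminated, and the equation left for it defines one of the varieties
   V_i: for M^6 and M^7, for example, the lines spanned by (1, x, y, 0) give V^(1) and the planes
   spanned by (1, 0, x, 0) and (0, 1, z, 0) give V^(2). *)

theory Submission
  imports Defs
begin

subsection \<open>Normal forms of subspaces\<close>

text \<open>In M^2 to M^7 the span of e1, e2, e3 is an abelian ideal on which only ad e4 acts, so
  the ideals inside it are the invariant subspaces of one 3 by 3 matrix. Lines are its eigenlines
  and planes are eigenlines of its transpose. A variety V is the characteristic polynomial rewritten
  in an echelon entry instead of the eigenvalue, and the two substitutions, one for the matrix and
  one for its transpose, are the reason why one matrix yields two different cubics. In M^12, M^13
  and M^14 every nonzero ideal contains e2, and modulo e2 the planes become eigenlines of a 2 by 2
  matrix. Codimension 1 is the linear case: the quotient by such an ideal is one-dimensional, so its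
  alternating bracket vanishes and the ideal contains the derived algebra. The coefficient of t
  therefore depends only on the dimension of the derived algebra and on q. The field is arbitrary in
  size and characteristic, so no enumeration of subspaces is possible; each cell is treated with its
  entries as variables.\<close>

definition vec4 :: "'a \<Rightarrow> 'a \<Rightarrow> 'a \<Rightarrow> 'a \<Rightarrow> 'a ^ 4" where
  "vec4 x y z w = (\<chi> i. if i = 1 then x else if i = 2 then y else if i = 3 then z else w)"

lemma vec4_nth [simp]:
  "vec4 x y z w $ 1 = x" "vec4 x y z w $ 2 = y" "vec4 x y z w $ 3 = z" "vec4 x y z w $ 4 = w"
  by (simp_all add: vec4_def)

lemma vec4_eq_iff:
  "vec4 x y z w = vec4 x' y' z' w' \<longleftrightarrow> x = x' \<and> y = y' \<and> z = z' \<and> w = w'"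
  by (auto simp: vec_eq_iff forall_4)

lemma vec4_eta: "vec4 (v $ 1) (v $ 2) (v $ 3) (v $ 4) = v"
  by (simp add: vec_eq_iff forall_4)

text \<open>The first argument holds the coefficients of a linear functional, the second the vector
  at which it is evaluated.\<close>

definition dot :: "'a::comm_ring_1 ^ 'n \<Rightarrow> 'a ^ 'n \<Rightarrow> 'a" where
  "dot f v = (\<Sum>i\<in>UNIV. f $ i * v $ i)"

lemma dot_add: "dot f (u + v) = dot f u + dot f v"
  by (simp add: dot_def sum.distrib distrib_left)

lemma dot_scale: "dot f (c *s v) = c * dot f v"
  by (simp add: dot_def sum_distrib_left mult.left_commute)

lemma dot_scale_left: "dot (c *s f) v = c * dot f v"
  by (simp add: dot_def sum_distrib_left mult.assoc)

lemma dot_zero: "dot f 0 = 0"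
  by (simp add: dot_def)

lemma dot_axis: "dot f (axis i 1) = f $ i"
  by (simp add: dot_def axis_def if_distrib[where f = "\<lambda>x. _ * x"] cong: if_cong)

lemma dot_minus: "dot f (u - v) = dot f u - dot f v"
  by (simp add: dot_def sum_subtractf right_diff_distrib)

text \<open>Representatives of the points of projective 3-space. They serve twice: as spanning
  vectors of lines and as functionals defining hyperplanes.\<close>

definition normalised :: "('k::field ^ 4) set" where
  "normalised = {v. v $ 1 = 1 \<or> v $ 1 = 0 \<and> v $ 2 = 1 \<or> v $ 1 = 0 \<and> v $ 2 = 0 \<and> v $ 3 = 1
     \<or> v $ 1 = 0 \<and> v $ 2 = 0 \<and> v $ 3 = 0 \<and> v $ 4 = 1}"

lemma normalised_nonzero: "v \<in> normalised \<Longrightarrow> v \<noteq> 0"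
  by (auto simp: normalised_def)

lemma normalised_scale_eq:
  assumes "u \<in> normalised" "c *s u \<in> normalised"
  shows "c *s u = u"
proof -
  have "c = 1" using assms by (auto simp: normalised_def)
  then show ?thesis by simp
qed

lemma normalise:
  assumes "v \<noteq> 0"
  obtains c where "c \<noteq> 0" "c *s v \<in> normalised"
proof -
  have "v $ 1 \<noteq> 0 \<or> v $ 2 \<noteq> 0 \<or> v $ 3 \<noteq> 0 \<or> v $ 4 \<noteq> 0"
    using assms by (auto simp: vec_eq_iff forall_4)
  then consider "v $ 1 \<noteq> 0" | "v $ 1 = 0" "v $ 2 \<noteq> 0" | "v $ 1 = 0" "v $ 2 = 0" "v $ 3 \<noteq> 0"
    | "v $ 1 = 0" "v $ 2 = 0" "v $ 3 = 0" "v $ 4 \<noteq> 0" by blast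
  then show ?thesis
  proof cases
    case 1
    then show ?thesis using that[of "inverse (v $ 1)"] by (simp add: normalised_def)
  next
    case 2
    then show ?thesis using that[of "inverse (v $ 2)"] by (simp add: normalised_def)
  next
    case 3
    then show ?thesis using that[of "inverse (v $ 3)"] by (simp add: normalised_def)
  next
    case 4
    then show ?thesis using that[of "inverse (v $ 4)"] by (simp add: normalised_def)
  qed
qed

lemma normalised_cases:
  assumes "v \<in> normalised"
  obtains x y z where "v = vec4 1 x y z" | x y where "v = vec4 0 1 x y"
    | x where "v = vec4 0 0 1 x" | "v = vec4 0 0 0 1"
proof -
  have "v = vec4 (v $ 1) (v $ 2) (v $ 3) (v $ 4)" by (simp add: vec4_eta)
  moreover have "v $ 1 = 1 \<or> v $ 1 = 0 \<and> v $ 2 = 1 \<or> v $ 1 = 0 \<and> v $ 2 = 0 \<and> v $ 3 = 1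
     \<or> v $ 1 = 0 \<and> v $ 2 = 0 \<and> v $ 3 = 0 \<and> v $ 4 = 1"
    using assms by (simp add: normalised_def)
  ultimately show ?thesis using that by metis
qed

text \<open>Projective 3-space is the disjoint union of affine cells of dimension 3, 2, 1 and 0. The
  predicate is left open so that the count applies to lines and to hyperplanes.\<close>

lemma card_normalised:
  fixes P :: "'k::{field,finite} ^ 4 \<Rightarrow> bool"
  shows "card {v \<in> normalised. P v} =
    card {(x, y, z). P (vec4 1 x y z)} + card {(x, y). P (vec4 0 1 x y)}
    + card {x. P (vec4 0 0 1 x)} + of_bool (P (vec4 0 0 0 1))"
proof -
  define A where "A = (\<lambda>(x, y, z). vec4 1 x y z) ` {(x, y, z). P (vec4 1 x y z)}"
  define B where "B = (\<lambda>(x, y). vec4 0 1 x y) ` {(x, y). P (vec4 0 1 x y)}"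
  define C where "C = (\<lambda>x. vec4 0 0 1 x) ` {x. P (vec4 0 0 1 x)}"
  define D where "D = {v. v = vec4 0 0 0 (1::'k) \<and> P v}"
  have "v \<in> A \<union> B \<union> C \<union> D" if "v \<in> normalised" "P v" for v
    using that(1)
    by (cases rule: normalised_cases)
      (use that in \<open>force simp: A_def B_def C_def D_def image_iff\<close>)+
  then have "{v \<in> normalised. P v} = A \<union> (B \<union> (C \<union> D))"
    by (auto simp: A_def B_def C_def D_def normalised_def)
  also have "card \<dots> = card A + (card B + (card C + card D))"
    by (subst card_Un_disjoint, simp, simp, force simp: A_def B_def C_def D_def vec4_eq_iff)+ simp
  also have "card A = card {(x, y, z). P (vec4 1 x y z)}"
    unfolding A_def by (rule card_image) (auto simp: inj_on_def vec4_eq_iff)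
  also have "card B = card {(x, y). P (vec4 0 1 x y)}"
    unfolding B_def by (rule card_image) (auto simp: inj_on_def vec4_eq_iff)
  also have "card C = card {x. P (vec4 0 0 1 x)}"
    unfolding C_def by (rule card_image) (auto simp: inj_on_def vec4_eq_iff)
  also have "D = (if P (vec4 0 0 0 1) then {vec4 0 0 0 1} else {})"
    by (auto simp: D_def)
  finally show ?thesis
    by simp
qed

section \<open>Lines as points of projective 3-space\<close>

lemma subspace_dim_1_iff:
  fixes I :: "('k::field ^ 'n) set"
  shows "vec.subspace I \<and> vec.dim I = 1 \<longleftrightarrow> (\<exists>v. v \<noteq> 0 \<and> I = vec.span {v})"
proof
  assume I: "vec.subspace I \<and> vec.dim I = 1"
  obtain B where B: "B \<subseteq> I" "vec.independent B" "I \<subseteq> vec.span B" "card B = vec.dim I"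
    using vec.basis_exists by blast
  then obtain v where "B = {v}" using I card_1_singletonE by metis
  with B I show "\<exists>v. v \<noteq> 0 \<and> I = vec.span {v}"
    by (metis vec.dependent_zero singletonI subset_antisym vec.span_minimal)
next
  assume "\<exists>v. v \<noteq> 0 \<and> I = vec.span {v}"
  then show "vec.subspace I \<and> vec.dim I = 1"
    by (auto simp: vec.dim_insert)
qed

lemma mem_span_singleton: "x \<in> vec.span {v} \<longleftrightarrow> (\<exists>c. x = c *s v)"
  by (auto simp: vec.span_singleton)

lemma lines_eq:
  "{I :: ('k::field ^ 4) set. vec.subspace I \<and> vec.dim I = 1} = (\<lambda>v. vec.span {v}) ` normalised"
proof (intro subset_antisym subsetI)
  fix I :: "('k ^ 4) set" assume "I \<in> {I. vec.subspace I \<and> vec.dim I = 1}"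
  then obtain v where v: "v \<noteq> 0" "I = vec.span {v}"
    unfolding mem_Collect_eq subspace_dim_1_iff by blast
  obtain c where c: "c \<noteq> 0" "c *s v \<in> normalised"
    using normalise v(1) by blast
  have "vec.span {c *s v} = vec.span {v}"
  proof -
    have "v = inverse c *s (c *s v)" using c(1) by (simp add: vector_smult_assoc)
    then have "v \<in> vec.span {c *s v}" unfolding mem_span_singleton by blast
    moreover have "c *s v \<in> vec.span {v}" unfolding mem_span_singleton by blast
    ultimately show ?thesis by (simp add: vec.span_eq)
  qed
  with c v show "I \<in> (\<lambda>v. vec.span {v}) ` normalised" by blast
next
  fix I :: "('k ^ 4) set" assume "I \<in> (\<lambda>v. vec.span {v}) ` normalised"
  then show "I \<in> {I. vec.subspace I \<and> vec.dim I = 1}"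
    using normalised_nonzero unfolding mem_Collect_eq subspace_dim_1_iff by blast
qed

lemma inj_on_line: "inj_on (\<lambda>v. vec.span {v}) (normalised :: ('k::field ^ 4) set)"
proof (rule inj_onI)
  fix u v :: "'k ^ 4"
  assume uv: "u \<in> normalised" "v \<in> normalised" "vec.span {u} = vec.span {v}"
  have "v \<in> vec.span {u}" using uv(3) vec.span_base by blast
  then obtain c where "v = c *s u" by (auto simp: mem_span_singleton)
  with normalised_scale_eq uv show "u = v" by metis
qed

section \<open>Hyperplanes as kernels of normalised functionals\<close>

lemma subspace_ker: "vec.subspace {v. dot f v = 0}"
  by (simp add: vec.subspace_def dot_zero dot_add dot_scale)

text \<open>A basis vector on which \<open>f\<close> does not vanish spans a complement of the
  kernel.\<close>

lemma dim_ker: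
  fixes f :: "'k::field ^ 'n"
  assumes "f \<noteq> 0"
  shows "vec.dim {v. dot f v = 0} + 1 = CARD('n)"
proof -
  obtain k where k: "f $ k \<noteq> 0" using assms by (auto simp: vec_eq_iff)
  let ?S = "insert (axis k 1) {v. dot f v = 0}"
  have "v \<in> vec.span ?S" for v
  proof -
    let ?c = "dot f v / f $ k"
    have "dot f (v - ?c *s axis k 1) = 0"
      using k by (simp add: dot_minus dot_scale dot_axis)
    then have "v - ?c *s axis k 1 \<in> vec.span ?S" by (intro vec.span_base) simp
    moreover have "?c *s axis k 1 \<in> vec.span ?S"
      by (intro vec.span_scale vec.span_base) simp
    ultimately have "(v - ?c *s axis k 1) + ?c *s axis k 1 \<in> vec.span ?S"
      by (rule vec.span_add)
    then show ?thesis by simp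
  qed
  then have "vec.span ?S = UNIV" by blast
  then have "vec.dim ?S = CARD('n)"
    using vec.dim_span[of ?S] vec_dim_card by metis
  moreover have "axis k 1 \<notin> vec.span {v. dot f v = 0}"
    using k by (simp add: vec.span_eq_iff[THEN iffD2, OF subspace_ker] dot_axis)
  ultimately show ?thesis by (simp add: vec.dim_insert)
qed

text \<open>Some basis vector \<open>axis k 1\<close> lies outside \<open>I\<close> and spans a
  complement. The coefficient \<open>g v\<close> of \<open>axis k 1\<close> in v modulo
  \<open>I\<close> is unique, and this uniqueness makes the function obtained by choice linear. Its
  zero set is \<open>I\<close>, and its values on the basis are the entries of the
  functional.\<close>

lemma hyperplane_eq_ker:
  fixes I :: "('k::field ^ 'n) set"
  assumes "vec.subspace I" "vec.dim I + 1 = CARD('n)"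
  obtains f where "f \<noteq> 0" "I = {v. dot f v = 0}"
proof -
  have "vec.span I = I" using assms(1) by simp
  have "\<exists>k. axis k 1 \<notin> I"
  proof (rule ccontr)
    assume "\<nexists>k. axis k 1 \<notin> I"
    then have "cart_basis \<subseteq> I" by (auto simp: cart_basis_def)
    then have "vec.span cart_basis \<subseteq> I" using assms(1) vec.span_minimal by blast
    then have "I = UNIV" by (simp add: top.extremum_unique)
    then show False using assms(2) vec_dim_card[where 'a = 'k and 'n = 'n] by simp
  qed
  then obtain k where k: "axis k 1 \<notin> I" by blast
  then have "vec.dim (insert (axis k 1) I) = CARD('n)"
    using assms(2) by (simp only: vec.dim_insert \<open>vec.span I = I\<close> if_False)
  then have "vec.span (insert (axis k 1) I) = UNIV"
    by (intro vec.subspace_dim_equal) (simp_all add: card_cart_basis del: vec.dim_insert)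
  then have "\<exists>c. v - c *s axis k 1 \<in> I" for v
    using \<open>vec.span I = I\<close> by (metis UNIV_I vec.span_breakdown_eq)
  then obtain g where g: "v - g v *s axis k 1 \<in> I" for v by metis
  have uniq: "g v = c" if "v - c *s axis k 1 \<in> I" for v c
  proof (rule ccontr)
    assume "g v \<noteq> c"
    have "(v - c *s axis k 1) - (v - g v *s axis k 1) \<in> I"
      using that g assms(1) vec.subspace_diff by blast
    also have "(v - c *s axis k 1) - (v - g v *s axis k 1) = (g v - c) *s axis k 1"
      by (simp add: vec_eq_iff algebra_simps)
    finally have "inverse (g v - c) *s ((g v - c) *s axis k 1) \<in> I"
      using assms(1) vec.subspace_scale by blast
    moreover have "inverse (g v - c) *s ((g v - c) *s axis k 1) = axis k 1"
      using \<open>g v \<noteq> c\<close> by (simp only: vector_smult_assoc) simp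
    ultimately show False using k by simp
  qed
  have g_add: "g (u + v) = g u + g v" for u v
  proof (rule uniq)
    have "u + v - (g u + g v) *s axis k 1 = (u - g u *s axis k 1) + (v - g v *s axis k 1)"
      by (simp add: vec_eq_iff algebra_simps)
    then show "u + v - (g u + g v) *s axis k 1 \<in> I"
      using g assms(1) vec.subspace_add by metis
  qed
  have g_scale: "g (c *s v) = c * g v" for c v
  proof (rule uniq)
    have "c *s v - (c * g v) *s axis k 1 = c *s (v - g v *s axis k 1)"
      by (simp add: vec_eq_iff algebra_simps)
    then show "c *s v - (c * g v) *s axis k 1 \<in> I"
      using g assms(1) vec.subspace_scale by metis
  qed
  have g_I: "v \<in> I \<longleftrightarrow> g v = 0" for v
    using g[of v] uniq[of v 0] by auto
  have g_sum: "g (\<Sum>i\<in>A. h i) = (\<Sum>i\<in>A. g (h i))" if "finite A" for h :: "'n \<Rightarrow> _" and A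
    using that
  proof (induction A rule: finite_induct)
    case empty
    then show ?case using g_scale[of 0 0] by simp
  qed (simp add: g_add)
  define f where "f = (\<chi> i. g (axis i 1))"
  have "g v = dot f v" for v
  proof -
    have "g v = g (\<Sum>i\<in>UNIV. v $ i *s axis i 1)" by (simp add: basis_expansion)
    also have "\<dots> = dot f v" by (simp add: g_sum g_scale dot_def f_def mult.commute)
    finally show ?thesis .
  qed
  with g_I have "I = {v. dot f v = 0}" by auto
  moreover have "f \<noteq> 0"
    using k calculation by (auto simp: dot_def)
  ultimately show thesis using that by blast
qed

lemma CARD_4: "CARD(4) = 4"
  by simp

lemma hyperplanes_eq:
  "{I :: ('k::field ^ 4) set. vec.subspace I \<and> vec.dim I + 1 = 4} =
    (\<lambda>f. {v. dot f v = 0}) ` normalised"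
proof (intro subset_antisym subsetI)
  fix I :: "('k ^ 4) set" assume "I \<in> {I. vec.subspace I \<and> vec.dim I + 1 = 4}"
  then obtain f where f: "f \<noteq> 0" "I = {v. dot f v = 0}"
    using hyperplane_eq_ker[of I] unfolding mem_Collect_eq CARD_4 by blast
  obtain c where c: "c \<noteq> 0" "c *s f \<in> normalised"
    using normalise f(1) by blast
  have "I = {v. dot (c *s f) v = 0}" using c f by (simp add: dot_scale_left)
  with c show "I \<in> (\<lambda>f. {v. dot f v = 0}) ` normalised" by blast
next
  fix I :: "('k ^ 4) set" assume "I \<in> (\<lambda>f. {v. dot f v = 0}) ` normalised"
  then obtain f where f: "f \<in> normalised" "I = {v. dot f v = 0}" by blast
  then show "I \<in> {I. vec.subspace I \<and> vec.dim I + 1 = 4}"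
    using dim_ker[OF normalised_nonzero[OF f(1)]] subspace_ker[of f] unfolding CARD_4 by blast
qed

lemma inj_on_ker: "inj_on (\<lambda>f. {v. dot f v = 0}) (normalised :: ('k::field ^ 4) set)"
proof (rule inj_onI)
  fix f g :: "'k ^ 4"
  assume fg: "f \<in> normalised" "g \<in> normalised" "{v. dot f v = 0} = {v. dot g v = 0}"
  obtain l where l: "f $ l = 1" using fg(1) by (auto simp: normalised_def)
  have "(g $ l *s f) $ j = g $ j" for j
  proof -
    \<comment> \<open>Evaluating \<open>g\<close> at these elements of the common kernel gives g_j =
      g_l f_j for every j, so \<open>g\<close> is a multiple of \<open>f\<close>.\<close>
    have "dot f (axis j 1 - f $ j *s axis l 1) = 0"
      by (simp add: dot_minus dot_scale dot_axis l)
    then have "dot g (axis j 1 - f $ j *s axis l 1) = 0" using fg(3) by blast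
    then show ?thesis by (simp add: dot_minus dot_scale dot_axis algebra_simps)
  qed
  then have "g = g $ l *s f" by (metis vec_eq_iff)
  with normalised_scale_eq fg show "f = g" by metis
qed

section \<open>Planes in reduced row echelon form: the six Schubert cells of the
  Grassmannian\<close>

definition rref :: "(('k::field ^ 4) \<times> ('k ^ 4)) set" where
  "rref = {(u, w).
      u $ 1 = 1 \<and> u $ 2 = 0 \<and> w $ 1 = 0 \<and> w $ 2 = 1
    \<or> u $ 1 = 1 \<and> u $ 3 = 0 \<and> w $ 1 = 0 \<and> w $ 2 = 0 \<and> w $ 3 = 1
    \<or> u $ 1 = 1 \<and> u $ 4 = 0 \<and> w $ 1 = 0 \<and> w $ 2 = 0 \<and> w $ 3 = 0 \<and> w $ 4 = 1
    \<or> u $ 1 = 0 \<and> u $ 2 = 1 \<and> u $ 3 = 0 \<and> w $ 1 = 0 \<and> w $ 2 = 0 \<and> w $ 3 = 1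
    \<or> u $ 1 = 0 \<and> u $ 2 = 1 \<and> u $ 4 = 0 \<and> w $ 1 = 0 \<and> w $ 2 = 0 \<and> w $ 3 = 0 \<and> w $ 4 = 1
    \<or> u $ 1 = 0 \<and> u $ 2 = 0 \<and> u $ 3 = 1 \<and> u $ 4 = 0 \<and> w $ 1 = 0 \<and> w $ 2 = 0 \<and> w $ 3 = 0 \<and> w $ 4 = 1}"

lemma vec4_in_rref:
  "(vec4 1 0 a b, vec4 0 1 c d) \<in> rref" "(vec4 1 a 0 b, vec4 0 0 1 c) \<in> rref"
  "(vec4 1 a b 0, vec4 0 0 0 1) \<in> rref" "(vec4 0 1 0 a, vec4 0 0 1 b) \<in> rref"
  "(vec4 0 1 a 0, vec4 0 0 0 1) \<in> rref" "(vec4 0 0 1 0, vec4 0 0 0 1) \<in> rref"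
  by (simp_all add: rref_def)

lemma rref_cases:
  assumes "(u, w) \<in> rref"
  obtains a b c d where "u = vec4 1 0 a b" "w = vec4 0 1 c d"
    | a b c where "u = vec4 1 a 0 b" "w = vec4 0 0 1 c"
    | a b where "u = vec4 1 a b 0" "w = vec4 0 0 0 1"
    | a b where "u = vec4 0 1 0 a" "w = vec4 0 0 1 b"
    | a where "u = vec4 0 1 a 0" "w = vec4 0 0 0 1"
    | "u = vec4 0 0 1 0" "w = vec4 0 0 0 1"
proof -
  have u: "u = vec4 (u $ 1) (u $ 2) (u $ 3) (u $ 4)" and w: "w = vec4 (w $ 1) (w $ 2) (w $ 3) (w $ 4)"
    by (simp_all add: vec4_eta)
  show ?thesis
    using assms unfolding rref_def mem_Collect_eq prod.case
    by (elim disjE conjE; insert u w; simp only:) (use that in \<open>blast\<close>)+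
qed

lemma mem_span_pair: "x \<in> vec.span {u, w} \<longleftrightarrow> (\<exists>a b. x = a *s u + b *s w)"
proof -
  have "x \<in> vec.span {u, w} \<longleftrightarrow> (\<exists>a b. x - a *s u = b *s w)"
    by (simp only: vec.span_breakdown_eq[of x u "{w}"] mem_span_singleton)
  also have "\<dots> \<longleftrightarrow> (\<exists>a b. x = a *s u + b *s w)"
    by (simp add: diff_eq_eq add.commute)
  finally show ?thesis .
qed

lemma dim_rref:
  assumes "(u, w) \<in> rref"
  shows "vec.dim (vec.span {u, w}) = 2"
proof -
  have "w \<noteq> 0" using assms by (cases rule: rref_cases) (auto simp: vec_eq_iff forall_4)
  moreover have "u \<notin> vec.span {w}"
    using assms unfolding mem_span_singleton
    by (cases rule: rref_cases) (auto simp: vec_eq_iff forall_4)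
  ultimately show ?thesis by (simp add: vec.dim_insert)
qed

text \<open>Uniqueness of the echelon form. Each basis is written in terms of the other; different
  pivot columns make the equations contradictory, and for equal pivot columns the pivot coordinates
  force the transition matrix to be the identity.\<close>

lemma inj_on_plane: "inj_on (\<lambda>(u, w). vec.span {u, w}) (rref :: (('k::field ^ 4) \<times> ('k ^ 4)) set)"
proof (rule inj_onI, clarify)
  fix u w u' w' :: "'k ^ 4"
  assume 1: "(u, w) \<in> rref" and 2: "(u', w') \<in> rref" and eq: "vec.span {u, w} = vec.span {u', w'}"
  have coords: "\<exists>a b. x = a *s u + b *s w" if "x \<in> {u', w'}" for x
    using that eq vec.span_base[of x "{u', w'}"] mem_span_pair[of x u w] by auto
  have coords': "\<exists>a b. x = a *s u' + b *s w'" if "x \<in> {u, w}" for x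
    using that eq vec.span_base[of x "{u, w}"] mem_span_pair[of x u' w'] by auto
  obtain a b c d where eqs: "u' = a *s u + b *s w" "w' = c *s u + d *s w"
    using coords[of u'] coords[of w'] by auto
  obtain a' b' c' d' where eqs': "u = a' *s u' + b' *s w'" "w = c' *s u' + d' *s w'"
    using coords'[of u] coords'[of w] by auto
  have "u' = a *s u + b *s w \<longrightarrow> w' = c *s u + d *s w \<longrightarrow>
    u = a' *s u' + b' *s w' \<longrightarrow> w = c' *s u' + d' *s w' \<longrightarrow> u = u' \<and> w = w'"
    by (rule rref_cases[OF 1]; rule rref_cases[OF 2]; simp add: vec_eq_iff forall_4) auto
  with eqs eqs' show "u = u' \<and> w = w'" by blast
qed

text \<open>Gaussian elimination carried out inside \<open>I\<close>, with elements of
  \<open>I\<close> in place of rows of a matrix.\<close>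

lemma planes_eq:
  "{I :: ('k::field ^ 4) set. vec.subspace I \<and> vec.dim I = 2} = (\<lambda>(u, w). vec.span {u, w}) ` rref"
proof (intro subset_antisym subsetI)
  fix I :: "('k ^ 4) set" assume "I \<in> {I. vec.subspace I \<and> vec.dim I = 2}"
  then have I: "vec.subspace I" "vec.dim I = 2" by auto
  have suffices: "I \<in> (\<lambda>(u, w). vec.span {u, w}) ` rref"
    if "u \<in> I" "w \<in> I" "(u, w) \<in> rref" for u w
  proof -
    have "vec.span {u, w} \<subseteq> I"
      using that I by (intro vec.span_minimal) auto
    then have "vec.span {u, w} = I"
      using I dim_rref[OF that(3)]
      by (intro vec.subspace_dim_equal[OF vec.subspace_span]) (simp_all del: vec.dim_span)
    with that(3) show ?thesis by (intro image_eqI[of _ _ "(u, w)"]) simp_all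
  qed
  \<comment> \<open>Since \<open>I\<close> has dimension 2, it contains a vector off the line
    through \<open>u\<close>. Clearing its entry in the pivot column \<open>p\<close> leaves it
    nonzero, and scaling afterwards keeps that entry zero.\<close>
  have second: "\<exists>w\<in>I. w \<in> normalised \<and> w $ p = 0" if "u \<in> I" "u $ p = 1" for u p
  proof -
    have "\<not> I \<subseteq> vec.span {u}"
      using I(2) vec.dim_mono[of I "{u}"] vec.dim_le_card'[of "{u}"] by fastforce
    then obtain v where v: "v \<in> I" "v \<notin> vec.span {u}" by blast
    let ?w = "v - v $ p *s u"
    have "?w \<noteq> 0" using v(2) by (auto simp: mem_span_singleton)
    then obtain c where c: "c \<noteq> 0" "c *s ?w \<in> normalised" by (rule normalise)
    moreover have "c *s ?w \<in> I"
      using I(1) v(1) that(1) by (intro vec.subspace_scale vec.subspace_diff)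
    ultimately show ?thesis using that(2) by (intro bexI[of _ "c *s ?w"]) auto
  qed
  \<comment> \<open>Here \<open>r\<close> is the pivot column of \<open>w\<close>; the subtraction
    clears the entry of \<open>u\<close> above that pivot.\<close>
  have finish: "I \<in> (\<lambda>(u, w). vec.span {u, w}) ` rref"
    if "u \<in> I" "w \<in> I" "(u - u $ r *s w, w) \<in> rref" for u w r
    using that I(1) suffices by (meson vec.subspace_diff vec.subspace_scale)
  have scaled: "\<exists>u\<in>I. u $ p = 1" if "v \<in> I" "v $ p \<noteq> 0" for v p
    using that vec.subspace_scale[OF I(1) that(1), of "inverse (v $ p)"]
    by (intro bexI[of _ "inverse (v $ p) *s v"]) auto
  \<comment> \<open>The cases locate the first column in which \<open>I\<close> is not identically
    zero. In the last one \<open>I\<close> would lie in a line.\<close>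
  consider (1) v where "v \<in> I" "v $ 1 \<noteq> 0"
    | (2) v where "\<forall>v\<in>I. v $ 1 = 0" "v \<in> I" "v $ 2 \<noteq> 0"
    | (3) v where "\<forall>v\<in>I. v $ 1 = 0 \<and> v $ 2 = 0" "v \<in> I" "v $ 3 \<noteq> 0"
    | (4) "\<forall>v\<in>I. v $ 1 = 0 \<and> v $ 2 = 0 \<and> v $ 3 = 0" by blast
  then show "I \<in> (\<lambda>(u, w). vec.span {u, w}) ` rref"
  proof cases
    case 1
    then obtain u where u: "u \<in> I" "u $ 1 = 1" using scaled by blast
    then obtain w where w: "w \<in> I" "w \<in> normalised" "w $ 1 = 0" using second by blast
    then have "w $ 2 = 1 \<or> w $ 2 = 0 \<and> w $ 3 = 1 \<or> w $ 2 = 0 \<and> w $ 3 = 0 \<and> w $ 4 = 1"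
      by (auto simp: normalised_def)
    then show ?thesis
      using finish[OF u(1) w(1), of 2] finish[OF u(1) w(1), of 3] finish[OF u(1) w(1), of 4] u w
      by (auto simp: rref_def)
  next
    case 2
    then obtain u where u: "u \<in> I" "u $ 2 = 1" using scaled by blast
    then obtain w where w: "w \<in> I" "w \<in> normalised" "w $ 2 = 0" using second by blast
    have "u $ 1 = 0" "w $ 1 = 0" using 2(1) u w by auto
    then have "w $ 3 = 1 \<or> w $ 3 = 0 \<and> w $ 4 = 1"
      using w by (auto simp: normalised_def)
    then show ?thesis
      using finish[OF u(1) w(1), of 3] finish[OF u(1) w(1), of 4] u w
        \<open>u $ 1 = 0\<close> \<open>w $ 1 = 0\<close>
      by (auto simp: rref_def)
  next
    case 3
    then obtain u where u: "u \<in> I" "u $ 3 = 1" using scaled by blast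
    then obtain w where w: "w \<in> I" "w \<in> normalised" "w $ 3 = 0" using second by blast
    have "u $ 1 = 0" "w $ 1 = 0" "u $ 2 = 0" "w $ 2 = 0" using 3(1) u w by auto
    then show ?thesis
      using finish[OF u(1) w(1), of 4] u w
      by (auto simp: rref_def normalised_def)
  next
    case 4
    then have "v = v $ 4 *s axis 4 1" if "v \<in> I" for v
      using that by (auto simp: vec_eq_iff forall_4 axis_def)
    then have "I \<subseteq> vec.span {axis 4 1}"
      unfolding subset_iff mem_span_singleton by blast
    then have "vec.dim I \<le> 1"
      using vec.dim_mono[of I "{axis 4 1}"] vec.dim_le_card'[of "{axis 4 1} :: ('k ^ 4) set"]
      by fastforce
    then show ?thesis using I(2) by simp
  qed
next
  fix I :: "('k ^ 4) set" assume "I \<in> (\<lambda>(u, w). vec.span {u, w}) ` rref"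
  then show "I \<in> {I. vec.subspace I \<and> vec.dim I = 2}"
    using dim_rref by auto
qed

text \<open>The cells have dimension 4, 3, 2, 2, 1 and 0, one for each pair of pivot
  columns.\<close>

lemma card_rref:
  fixes P :: "'k::{field,finite} ^ 4 \<Rightarrow> 'k ^ 4 \<Rightarrow> bool"
  shows "card {(u, w). (u, w) \<in> rref \<and> P u w} =
    card {(a, b, c, d). P (vec4 1 0 a b) (vec4 0 1 c d)}
    + card {(a, b, c). P (vec4 1 a 0 b) (vec4 0 0 1 c)}
    + card {(a, b). P (vec4 1 a b 0) (vec4 0 0 0 1)}
    + card {(a, b). P (vec4 0 1 0 a) (vec4 0 0 1 b)}
    + card {a. P (vec4 0 1 a 0) (vec4 0 0 0 1)}
    + of_bool (P (vec4 0 0 1 0) (vec4 0 0 0 1))"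
proof -
  define A where "A = (\<lambda>(a, b, c, d). (vec4 1 0 a b, vec4 0 1 c d)) `
    {(a, b, c, d). P (vec4 1 0 a b) (vec4 0 1 c d)}"
  define B where "B = (\<lambda>(a, b, c). (vec4 1 a 0 b, vec4 0 0 1 c)) `
    {(a, b, c). P (vec4 1 a 0 b) (vec4 0 0 1 c)}"
  define C where "C = (\<lambda>(a, b). (vec4 1 a b 0, vec4 0 0 0 (1::'k))) `
    {(a, b). P (vec4 1 a b 0) (vec4 0 0 0 1)}"
  define D where "D = (\<lambda>(a, b). (vec4 0 1 0 a, vec4 0 0 1 b)) `
    {(a, b). P (vec4 0 1 0 a) (vec4 0 0 1 b)}"
  define E where "E = (\<lambda>a. (vec4 0 1 a 0, vec4 0 0 0 (1::'k))) `
    {a. P (vec4 0 1 a 0) (vec4 0 0 0 1)}"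
  define F where "F = {(u, w). u = vec4 0 0 1 (0::'k) \<and> w = vec4 0 0 0 (1::'k) \<and> P u w}"
  note defs = A_def B_def C_def D_def E_def F_def
  have "P (vec4 1 0 a b) (vec4 0 1 c d) \<Longrightarrow> (vec4 1 0 a b, vec4 0 1 c d) \<in> A"
    "P (vec4 1 a 0 b) (vec4 0 0 1 c) \<Longrightarrow> (vec4 1 a 0 b, vec4 0 0 1 c) \<in> B"
    "P (vec4 1 a b 0) (vec4 0 0 0 1) \<Longrightarrow> (vec4 1 a b 0, vec4 0 0 0 1) \<in> C"
    "P (vec4 0 1 0 a) (vec4 0 0 1 b) \<Longrightarrow> (vec4 0 1 0 a, vec4 0 0 1 b) \<in> D"
    "P (vec4 0 1 a 0) (vec4 0 0 0 1) \<Longrightarrow> (vec4 0 1 a 0, vec4 0 0 0 1) \<in> E"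
    "P (vec4 0 0 1 0) (vec4 0 0 0 1) \<Longrightarrow> (vec4 0 0 1 0, vec4 0 0 0 1) \<in> F" for a b c d
    by (force simp: defs)+
  note mem = this
  have "(u, w) \<in> A \<union> (B \<union> (C \<union> (D \<union> (E \<union> F))))" if "(u, w) \<in> rref" "P u w" for u w
    by (rule rref_cases[OF that(1)]) (use that mem in simp_all)
  then have "{(u, w). (u, w) \<in> rref \<and> P u w} \<subseteq> A \<union> (B \<union> (C \<union> (D \<union> (E \<union> F))))"
    by blast
  moreover have "A \<union> (B \<union> (C \<union> (D \<union> (E \<union> F)))) \<subseteq> {(u, w). (u, w) \<in> rref \<and> P u w}"
    by (auto simp: defs vec4_in_rref)
  ultimately have "{(u, w). (u, w) \<in> rref \<and> P u w} = A \<union> (B \<union> (C \<union> (D \<union> (E \<union> F))))"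
    by (rule subset_antisym)
  also have "card \<dots> = card A + (card B + (card C + (card D + (card E + card F))))"
    by (subst card_Un_disjoint, simp, simp, force simp: defs vec4_eq_iff)+ simp
  also have "card A = card {(a, b, c, d). P (vec4 1 0 a b) (vec4 0 1 c d)}"
    unfolding A_def by (rule card_image) (auto simp: inj_on_def vec4_eq_iff)
  also have "card B = card {(a, b, c). P (vec4 1 a 0 b) (vec4 0 0 1 c)}"
    unfolding B_def by (rule card_image) (auto simp: inj_on_def vec4_eq_iff)
  also have "card C = card {(a, b). P (vec4 1 a b 0) (vec4 0 0 0 1)}"
    unfolding C_def by (rule card_image) (auto simp: inj_on_def vec4_eq_iff)
  also have "card D = card {(a, b). P (vec4 0 1 0 a) (vec4 0 0 1 b)}"
    unfolding D_def by (rule card_image) (auto simp: inj_on_def vec4_eq_iff)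
  also have "card E = card {a. P (vec4 0 1 a 0) (vec4 0 0 0 1)}"
    unfolding E_def by (rule card_image) (auto simp: inj_on_def vec4_eq_iff)
  also have "F = (if P (vec4 0 0 1 0) (vec4 0 0 0 1) then {(vec4 0 0 1 0, vec4 0 0 0 1)} else {})"
    by (auto simp: F_def)
  finally show ?thesis
    by simp
qed

subsection \<open>Ideals in normal form\<close>

text \<open>Applied to the bracket in either slot, this reduces stability of a subspace to brackets
  with basis vectors.\<close>

lemma linear_image_mem_subspace:
  fixes f :: "'k::field ^ 'n \<Rightarrow> 'k ^ 'm"
  assumes "vec.subspace I" "\<And>i. f (axis i 1) \<in> I"
    and "\<And>x y. f (x + y) = f x + f y" "\<And>c x. f (c *s x) = c *s f x"
  shows "f x \<in> I"
proof -
  have "vec.subspace {x. f x \<in> I}"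
    using assms(1,3) assms(4)[of 0]
    by (auto simp: vec.subspace_def assms(3,4))
  moreover have "cart_basis \<subseteq> {x. f x \<in> I}"
    using assms(2) by (auto simp: cart_basis_def)
  ultimately have "vec.span cart_basis \<subseteq> {x. f x \<in> I}"
    by (intro vec.span_minimal)
  then show ?thesis by auto
qed

context lie_algebra
begin

lemma zero_right: "br x 0 = 0"
  using scale_right[of x 0 0] by simp

lemma antisym: "br x y = - br y x"
proof -
  have "0 = br (x + y) (x + y)" by (rule alternating[symmetric])
  also have "\<dots> = br x y + br y x" by (simp only: add_left add_right) (simp add: alternating)
  finally show ?thesis by (simp add: eq_neg_iff_add_eq_0)
qed

lemma lie_ideal_span_iff:
  "lie_ideal br (vec.span S) \<longleftrightarrow> (\<forall>i. \<forall>y\<in>S. br (axis i 1) y \<in> vec.span S)"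
proof
  assume "lie_ideal br (vec.span S)"
  then show "\<forall>i. \<forall>y\<in>S. br (axis i 1) y \<in> vec.span S"
    by (auto simp: lie_ideal_def vec.span_base)
next
  assume *: "\<forall>i. \<forall>y\<in>S. br (axis i 1) y \<in> vec.span S"
  have "br x y \<in> vec.span S" if "y \<in> S" for x y
    by (rule linear_image_mem_subspace[where f = "\<lambda>x. br x y"])
      (use * that in \<open>auto simp: add_left scale_left\<close>)
  moreover have "vec.subspace {y. br x y \<in> vec.span S}" for x
    by (auto simp: vec.subspace_def zero_right add_right scale_right vec.span_zero
        intro: vec.span_add vec.span_scale)
  ultimately have "br x y \<in> vec.span S" if "y \<in> vec.span S" for x y
    using that vec.span_minimal[of S "{y. br x y \<in> vec.span S}"] by blast
  then show "lie_ideal br (vec.span S)"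
    by (simp add: lie_ideal_def)
qed

text \<open>Modulo a hyperplane ideal the algebra is one-dimensional, and an alternating bracket on
  a line is zero, so the ideal contains every bracket. Conversely, any subspace containing all
  brackets is an ideal.\<close>

lemma lie_ideal_ker_iff:
  assumes "f \<noteq> 0"
  shows "lie_ideal br {v. dot f v = 0} \<longleftrightarrow> (\<forall>i j. dot f (br (axis i 1) (axis j 1)) = 0)"
proof
  assume I: "lie_ideal br {v. dot f v = 0}"
  obtain k where k: "f $ k \<noteq> 0" using assms by (auto simp: vec_eq_iff)
  have "dot f (br x y) = 0" for x y
  proof -
    let ?e = "axis k 1"
    let ?c = "dot f x / f $ k" and ?d = "dot f y / f $ k"
    \<comment> \<open>Components in the kernel: in the expansion of the bracket every term with
      \<open>x0\<close> or \<open>y0\<close> stays in the ideal, and the only other term is a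
      multiple of the bracket of \<open>axis k 1\<close> with itself.\<close>
    define x0 y0 where "x0 = x - ?c *s ?e" and "y0 = y - ?d *s ?e"
    have x: "x = x0 + ?c *s ?e" and y: "y = y0 + ?d *s ?e"
      by (simp_all add: x0_def y0_def)
    have "dot f x0 = 0" "dot f y0 = 0"
      using k by (simp_all add: x0_def y0_def dot_minus dot_scale dot_axis)
    then have 0: "dot f (br z x0) = 0" "dot f (br z y0) = 0" for z
      using I by (auto simp: lie_ideal_def)
    have "br x0 ?e = - br ?e x0" by (rule antisym)
    then have "dot f (br x0 ?e) = 0"
      using 0(1)[of ?e] dot_scale[of f "- 1" "br ?e x0"] by simp
    then show ?thesis
      by (subst x, subst y)
        (simp add: add_left add_right scale_left scale_right alternating dot_add dot_scale 0)
  qed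
  then show "\<forall>i j. dot f (br (axis i 1) (axis j 1)) = 0" by blast
next
  assume *: "\<forall>i j. dot f (br (axis i 1) (axis j 1)) = 0"
  have **: "br x (axis j 1) \<in> {v. dot f v = 0}" for x j
    by (rule linear_image_mem_subspace[where f = "\<lambda>x. br x (axis j 1)", OF subspace_ker])
      (use * in \<open>auto simp: add_left scale_left\<close>)
  have "br x y \<in> {v. dot f v = 0}" for x y
    by (rule linear_image_mem_subspace[where f = "br x", OF subspace_ker **])
      (simp_all add: add_right scale_right)
  then show "lie_ideal br {v. dot f v = 0}"
    by (simp add: lie_ideal_def subspace_ker)
qed

end

text \<open>The indices \<open>j\<close>, \<open>k\<close> below are the pivot columns of the echelon form: the coefficients of
  an element of the subspace with respect to its echelon basis are its coordinates there.\<close>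

definition line_ideal :: "('k::field ^ 'n \<Rightarrow> 'k ^ 'n \<Rightarrow> 'k ^ 'n) \<Rightarrow> 'n \<Rightarrow> 'k ^ 'n \<Rightarrow> bool" where
  "line_ideal br k v \<longleftrightarrow> (\<forall>i. br (axis i 1) v = (br (axis i 1) v $ k) *s v)"

definition plane_ideal ::
  "('k::field ^ 'n \<Rightarrow> 'k ^ 'n \<Rightarrow> 'k ^ 'n) \<Rightarrow> 'n \<Rightarrow> 'n \<Rightarrow> 'k ^ 'n \<Rightarrow> 'k ^ 'n \<Rightarrow> bool" where
  "plane_ideal br j k u w \<longleftrightarrow>
    (\<forall>i. br (axis i 1) u = (br (axis i 1) u $ j) *s u + (br (axis i 1) u $ k) *s w \<and>
      br (axis i 1) w = (br (axis i 1) w $ j) *s u + (br (axis i 1) w $ k) *s w)"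

definition ker_ideal :: "('k::field ^ 'n \<Rightarrow> 'k ^ 'n \<Rightarrow> 'k ^ 'n) \<Rightarrow> 'k ^ 'n \<Rightarrow> bool" where
  "ker_ideal br f \<longleftrightarrow> (\<forall>i j. dot f (br (axis i 1) (axis j 1)) = 0)"

lemma (in lie_algebra) lie_ideal_line_iff:
  assumes "v $ k = 1"
  shows "lie_ideal br (vec.span {v}) \<longleftrightarrow> line_ideal br k v"
proof -
  have "x \<in> vec.span {v} \<longleftrightarrow> x = (x $ k) *s v" for x
    using assms unfolding mem_span_singleton by auto
  then show ?thesis
    unfolding lie_ideal_span_iff line_ideal_def by auto
qed

lemma (in lie_algebra) lie_ideal_plane_iff:
  assumes "u $ j = 1" "u $ k = 0" "w $ j = 0" "w $ k = 1"
  shows "lie_ideal br (vec.span {u, w}) \<longleftrightarrow> plane_ideal br j k u w"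
proof -
  have "x \<in> vec.span {u, w} \<longleftrightarrow> x = (x $ j) *s u + (x $ k) *s w" for x
    using assms unfolding mem_span_pair by auto
  then show ?thesis
    unfolding lie_ideal_span_iff plane_ideal_def by auto
qed

section \<open>Counting ideals of each codimension\<close>

context
  fixes br :: "'k::{field,finite} ^ 4 \<Rightarrow> 'k ^ 4 \<Rightarrow> 'k ^ 4"
  assumes br: "lie_algebra br"
begin

interpretation lie_algebra br
  by (rule br)

lemma num_ideals_4: "num_ideals br 4 = 1"
proof -
  have "{I. lie_ideal br I \<and> vec.dim I + 4 = CARD(4)} = {{0}}"
    using vec.subspace_0 by (auto simp: lie_ideal_def zero_right)
  then show ?thesis by (simp add: num_ideals_def)
qed

lemma num_ideals_0: "num_ideals br 0 = 1"
proof -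
  have "I = UNIV" if "vec.subspace I" "vec.dim I = CARD(4)" for I :: "('k ^ 4) set"
    using that by (intro vec.subspace_dim_equal) (simp_all add: card_cart_basis)
  moreover have "vec.dim (UNIV :: ('k ^ 4) set) = CARD(4)"
    by (rule vec_dim_card)
  ultimately have "{I. lie_ideal br I \<and> vec.dim I + 0 = CARD(4)} = {UNIV}"
    by (auto simp: lie_ideal_def)
  then show ?thesis by (simp add: num_ideals_def)
qed

text \<open>Codimension 3 means dimension 1, so these are the lines; the index passed to
  \<open>line_ideal\<close> is the pivot of the cell.\<close>

lemma num_ideals_3:
  "num_ideals br 3 =
    card {(x, y, z). line_ideal br 1 (vec4 1 x y z)}
    + card {(x, y). line_ideal br 2 (vec4 0 1 x y)}
    + card {x. line_ideal br 3 (vec4 0 0 1 x)} + of_bool (line_ideal br 4 (vec4 0 0 0 1))"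
proof -
  have "{I. lie_ideal br I \<and> vec.dim I + 3 = CARD(4)} =
    {I \<in> {I. vec.subspace I \<and> vec.dim I = 1}. lie_ideal br I}"
    by (auto simp: lie_ideal_def)
  also have "\<dots> = (\<lambda>v. vec.span {v}) ` {v \<in> normalised. lie_ideal br (vec.span {v})}"
    unfolding lines_eq by blast
  finally have "num_ideals br 3 =
      card ((\<lambda>v. vec.span {v}) ` {v \<in> normalised. lie_ideal br (vec.span {v})})"
    by (simp add: num_ideals_def)
  also have "\<dots> = card {v \<in> normalised. lie_ideal br (vec.span {v})}"
    by (intro card_image inj_on_subset[OF inj_on_line]) auto
  finally show ?thesis
    unfolding card_normalised
    by (simp add: lie_ideal_line_iff[where k = 1] lie_ideal_line_iff[where k = 2]
        lie_ideal_line_iff[where k = 3] lie_ideal_line_iff[where k = 4])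
qed

text \<open>The condition is linear in the functional, so no point count of a variety can occur in
  the coefficient of t.\<close>

lemma num_ideals_1:
  "num_ideals br 1 =
    card {(x, y, z). ker_ideal br (vec4 1 x y z)} + card {(x, y). ker_ideal br (vec4 0 1 x y)}
    + card {x. ker_ideal br (vec4 0 0 1 x)} + of_bool (ker_ideal br (vec4 0 0 0 1))"
proof -
  have "{I. lie_ideal br I \<and> vec.dim I + 1 = CARD(4)} =
    {I \<in> {I. vec.subspace I \<and> vec.dim I + 1 = 4}. lie_ideal br I}"
    by (auto simp: lie_ideal_def)
  also have "\<dots> = (\<lambda>f. {v. dot f v = 0}) ` {f \<in> normalised. lie_ideal br {v. dot f v = 0}}"
    unfolding hyperplanes_eq by blast
  also have "{f \<in> normalised. lie_ideal br {v. dot f v = 0}} = {f \<in> normalised. ker_ideal br f}"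
    using lie_ideal_ker_iff normalised_nonzero unfolding ker_ideal_def by blast
  finally have "num_ideals br 1 =
      card ((\<lambda>f. {v. dot f v = 0}) ` {f \<in> normalised. ker_ideal br f})"
    by (simp add: num_ideals_def)
  also have "\<dots> = card {f \<in> normalised. ker_ideal br f}"
    by (intro card_image inj_on_subset[OF inj_on_ker]) auto
  finally show ?thesis
    unfolding card_normalised .
qed

lemma num_ideals_2:
  "num_ideals br 2 =
    card {(a, b, c, d). plane_ideal br 1 2 (vec4 1 0 a b) (vec4 0 1 c d)}
    + card {(a, b, c). plane_ideal br 1 3 (vec4 1 a 0 b) (vec4 0 0 1 c)}
    + card {(a, b). plane_ideal br 1 4 (vec4 1 a b 0) (vec4 0 0 0 1)}
    + card {(a, b). plane_ideal br 2 3 (vec4 0 1 0 a) (vec4 0 0 1 b)}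
    + card {a. plane_ideal br 2 4 (vec4 0 1 a 0) (vec4 0 0 0 1)}
    + of_bool (plane_ideal br 3 4 (vec4 0 0 1 0) (vec4 0 0 0 1))"
proof -
  let ?span = "\<lambda>(u, w). vec.span {u, w} :: ('k ^ 4) set"
  let ?S = "{(u, w). (u, w) \<in> rref \<and> lie_ideal br (vec.span {u, w})}"
  have "{I. lie_ideal br I \<and> vec.dim I + 2 = CARD(4)} =
    {I \<in> {I. vec.subspace I \<and> vec.dim I = 2}. lie_ideal br I}"
    by (auto simp: lie_ideal_def)
  also have "\<dots> = ?span ` ?S"
    unfolding planes_eq by auto
  finally have "num_ideals br 2 = card (?span ` ?S)"
    by (simp add: num_ideals_def)
  also have "\<dots> = card ?S"
    by (intro card_image inj_on_subset[OF inj_on_plane]) auto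
  finally show ?thesis
    unfolding card_rref
    by (simp add: lie_ideal_plane_iff[where j = 1 and k = 2] lie_ideal_plane_iff[where j = 1 and k = 3]
        lie_ideal_plane_iff[where j = 1 and k = 4] lie_ideal_plane_iff[where j = 2 and k = 3]
        lie_ideal_plane_iff[where j = 2 and k = 4] lie_ideal_plane_iff[where j = 3 and k = 4])
qed

lemma ideal_zeta_eq:
  assumes "t = of_nat CARD('k) powr (- s)"
  shows "ideal_zeta br s = 1 + of_nat (num_ideals br 1) * t + of_nat (num_ideals br 2) * t^2
    + of_nat (num_ideals br 3) * t^3 + t^4"
proof -
  have "{..CARD(4)} = {0, 1, 2, 3, 4::nat}" by auto
  then show ?thesis
    unfolding ideal_zeta_def assms by (simp add: num_ideals_0 num_ideals_4)
qed

end

subsection \<open>Ideal conditions for the individual Lie algebras\<close>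

lemmas ideal_conds = line_ideal_def plane_ideal_def ker_ideal_def dot_def sum_4 vec_eq_iff
  forall_4 axis_def bracket_of_def

text \<open>Here ad e4 is the identity on the span of e1, e2, e3, so every subspace of that span is
  an ideal. An ideal with an element outside it contains e1, e2, e3 and is the whole
  algebra.\<close>

lemma M2_cells:
  fixes x y z w :: "'k::field"
  shows
    "line_ideal M2 1 (vec4 1 x y z) \<longleftrightarrow> z = 0"
    "line_ideal M2 2 (vec4 0 1 x y) \<longleftrightarrow> y = 0"
    "line_ideal M2 3 (vec4 0 0 1 x) \<longleftrightarrow> x = 0"
    "\<not> line_ideal M2 4 (vec4 0 0 0 1)"
    "plane_ideal M2 1 2 (vec4 1 0 x y) (vec4 0 1 z w) \<longleftrightarrow> y = 0 \<and> w = 0"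
    "plane_ideal M2 1 3 (vec4 1 x 0 y) (vec4 0 0 1 z) \<longleftrightarrow> y = 0 \<and> z = 0"
    "\<not> plane_ideal M2 1 4 (vec4 1 x y 0) (vec4 0 0 0 1)"
    "plane_ideal M2 2 3 (vec4 0 1 0 x) (vec4 0 0 1 y) \<longleftrightarrow> x = 0 \<and> y = 0"
    "\<not> plane_ideal M2 2 4 (vec4 0 1 x 0) (vec4 0 0 0 1)"
    "\<not> plane_ideal M2 3 4 (vec4 0 0 1 0) (vec4 0 0 0 1)"
    "ker_ideal M2 (vec4 x y z w) \<longleftrightarrow> x = 0 \<and> y = 0 \<and> z = 0"
  by (auto simp: M2_def ideal_conds)

text \<open>On the span of e2 and e3 the map ad e4 has characteristic polynomial (T - 1)(T - a). The
  eigenvalue of (0, 1, x, 0) is - a x, so x = - 1 belongs to the eigenvalue a and a x = - 1 to the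
  eigenvalue 1.\<close>

lemma M3_line_2:
  fixes x y a :: "'k::field"
  shows "line_ideal (M3 a) 2 (vec4 0 1 x y) \<longleftrightarrow> (x = - 1 \<or> a * x = - 1) \<and> y = 0"
proof -
  have "line_ideal (M3 a) 2 (vec4 0 1 x y) \<longleftrightarrow> 1 + (x * a + x) = - (x * a * x) \<and> y = 0"
    by (auto simp: M3_def ideal_conds)
  also have "1 + (x * a + x) = - (x * a * x) \<longleftrightarrow> (x + 1) * (a * x + 1) = 0"
    by algebra
  finally show ?thesis by (simp add: eq_neg_iff_add_eq_0)
qed

text \<open>Modulo the eigenvector e2 - e3 the map ad e4 is the identity on the span of e1, e2, e3.
  So for z = - 1 the entry \<open>x\<close> is free. For other z the plane is spanned by e1 and the
  eigenvector of eigenvalue 1 in the span of e2 and e3.\<close>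

lemma M3_plane_12:
  fixes x y z w a :: "'k::field"
  shows "plane_ideal (M3 a) 1 2 (vec4 1 0 x y) (vec4 0 1 z w) \<longleftrightarrow>
      y = 0 \<and> (z = - 1 \<or> a * z = - 1 \<and> x = 0) \<and> w = 0"
proof -
  have "plane_ideal (M3 a) 1 2 (vec4 1 0 x y) (vec4 0 1 z w) \<longleftrightarrow>
      x * a = - (x * a * z) \<and> y = 0 \<and> 1 + (z * a + z) = - (z * a * z) \<and> w = 0"
    by (simp add: M3_def ideal_conds, safe; simp)
  also have "x * a = - (x * a * z) \<longleftrightarrow> x * a * (z + 1) = 0"
    by algebra
  also have "1 + (z * a + z) = - (z * a * z) \<longleftrightarrow> (z + 1) * (a * z + 1) = 0"
    by algebra
  finally show ?thesis by (auto simp: eq_neg_iff_add_eq_0)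
qed

lemma M3_cells:
  fixes x y z w a :: "'k::field"
  shows
    "line_ideal (M3 a) 1 (vec4 1 x y z) \<longleftrightarrow> x = -(y * a) \<and> z = 0"
    "line_ideal (M3 a) 3 (vec4 0 0 1 x) \<longleftrightarrow> x = 0 \<and> a = 0"
    "\<not> line_ideal (M3 a) 4 (vec4 0 0 0 1)"
    "plane_ideal (M3 a) 1 3 (vec4 1 x 0 y) (vec4 0 0 1 z) \<longleftrightarrow> x = 0 \<and> y = 0 \<and> z = 0 \<and> a = 0"
    "\<not> plane_ideal (M3 a) 1 4 (vec4 1 x y 0) (vec4 0 0 0 1)"
    "plane_ideal (M3 a) 2 3 (vec4 0 1 0 x) (vec4 0 0 1 y) \<longleftrightarrow> x = 0 \<and> y = 0"
    "\<not> plane_ideal (M3 a) 2 4 (vec4 0 1 x 0) (vec4 0 0 0 1)"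
    "\<not> plane_ideal (M3 a) 3 4 (vec4 0 0 1 0) (vec4 0 0 0 1)"
    "ker_ideal (M3 a) (vec4 x y z w) \<longleftrightarrow> x = 0 \<and> a * y = 0 \<and> z = 0"
  by (auto simp: M3_def ideal_conds)

text \<open>The derived algebra is the line through e3, so an ideal either contains e3 or is
  central. The centre is spanned by e1 and e2 - e3 and misses e3, which gives one plane beyond those
  through e3, and one line beyond the central ones, namely that of e3.\<close>

lemma M4_cells:
  fixes x y z w :: "'k::field"
  shows
    "line_ideal M4 1 (vec4 1 x y z) \<longleftrightarrow> y = - x \<and> z = 0"
    "line_ideal M4 2 (vec4 0 1 x y) \<longleftrightarrow> x = - 1 \<and> y = 0"
    "line_ideal M4 3 (vec4 0 0 1 x) \<longleftrightarrow> x = 0"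
    "\<not> line_ideal M4 4 (vec4 0 0 0 1)"
    "plane_ideal M4 1 2 (vec4 1 0 x y) (vec4 0 1 z w) \<longleftrightarrow> x = 0 \<and> y = 0 \<and> z = - 1 \<and> w = 0"
    "plane_ideal M4 1 3 (vec4 1 x 0 y) (vec4 0 0 1 z) \<longleftrightarrow> z = 0"
    "\<not> plane_ideal M4 1 4 (vec4 1 x y 0) (vec4 0 0 0 1)"
    "plane_ideal M4 2 3 (vec4 0 1 0 x) (vec4 0 0 1 y) \<longleftrightarrow> y = 0"
    "\<not> plane_ideal M4 2 4 (vec4 0 1 x 0) (vec4 0 0 0 1)"
    "plane_ideal M4 3 4 (vec4 0 0 1 0) (vec4 0 0 0 1)"
    "ker_ideal M4 (vec4 x y z w) \<longleftrightarrow> z = 0"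
  by (auto simp: M4_def ideal_conds add_eq_0_iff)

text \<open>Here e3 is itself central: the lines are exactly the central lines, and every plane
  ideal contains e3.\<close>

lemma M5_cells:
  fixes x y z w :: "'k::field"
  shows
    "line_ideal M5 1 (vec4 1 x y z) \<longleftrightarrow> x = 0 \<and> z = 0"
    "\<not> line_ideal M5 2 (vec4 0 1 x y)"
    "line_ideal M5 3 (vec4 0 0 1 x) \<longleftrightarrow> x = 0"
    "\<not> line_ideal M5 4 (vec4 0 0 0 1)"
    "\<not> plane_ideal M5 1 2 (vec4 1 0 x y) (vec4 0 1 z w)"
    "plane_ideal M5 1 3 (vec4 1 x 0 y) (vec4 0 0 1 z) \<longleftrightarrow> z = 0"
    "\<not> plane_ideal M5 1 4 (vec4 1 x y 0) (vec4 0 0 0 1)"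
    "plane_ideal M5 2 3 (vec4 0 1 0 x) (vec4 0 0 1 y) \<longleftrightarrow> y = 0"
    "\<not> plane_ideal M5 2 4 (vec4 0 1 x 0) (vec4 0 0 0 1)"
    "plane_ideal M5 3 4 (vec4 0 0 1 0) (vec4 0 0 0 1)"
    "ker_ideal M5 (vec4 x y z w) \<longleftrightarrow> z = 0"
  by (auto simp: M5_def ideal_conds)

text \<open>The eigenvalue of (1, x, y, 0) under ad e4 is T = a y. Substituting this in T^3 - T^2 -
  b T - a and, for nonzero a, dividing by - a gives the cubic of \<open>V6_1\<close>.\<close>

lemma M6_line_1:
  fixes x y z a b :: "'k::field"
  shows
    "line_ideal (M6 a b) 1 (vec4 1 x y z) \<longleftrightarrow> x = a * y^2 - y \<and> y \<in> V6_1 a b \<and> z = 0"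
proof -
  have "line_ideal (M6 a b) 1 (vec4 1 x y z) \<longleftrightarrow>
      1 + y * b = y * a * x \<and> x + y = y * a * y \<and> z = 0"
    by (auto simp: M6_def ideal_conds)
  also have "\<dots> \<longleftrightarrow> x = a * y^2 - y \<and> y \<in> V6_1 a b \<and> z = 0"
    unfolding V6_1_def mem_Collect_eq by algebra
  finally show ?thesis .
qed

text \<open>The first coordinate of the bracket is a x, and x = 0 is impossible, so a = 0. The
  eigenvalue is then b x on the invariant span of e2 and e3.\<close>

lemma M6_line_2:
  fixes x y a b :: "'k::field"
  shows
    "line_ideal (M6 a b) 2 (vec4 0 1 x y) \<longleftrightarrow> a = 0 \<and> x \<in> V3 b \<and> y = 0"
proof -
  have "line_ideal (M6 a b) 2 (vec4 0 1 x y) \<longleftrightarrow>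
      a = 0 \<and> 1 + x = x * b * x \<and> y = 0"
    by (auto simp: M6_def ideal_conds)
  also have "\<dots> \<longleftrightarrow> a = 0 \<and> x \<in> V3 b \<and> y = 0"
    unfolding V3_def mem_Collect_eq by algebra
  finally show ?thesis .
qed

text \<open>Inside the span of e1, e2, e3 the plane is the kernel of the functional (-x, -z, 1),
  which must be an eigenvector of the transpose of ad e4. Its eigenvalue is T = - 1 / z, which
  forces x = - z^2, and multiplying the characteristic polynomial by - z^3 gives
  \<open>V6_2\<close>.\<close>

lemma M6_plane_12:
  fixes x y z w a b :: "'k::field"
  shows
    "plane_ideal (M6 a b) 1 2 (vec4 1 0 x y) (vec4 0 1 z w) \<longleftrightarrow>
      x = -(z^2) \<and> y = 0 \<and> z \<in> V6_2 a b \<and> w = 0"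
proof -
  have "plane_ideal (M6 a b) 1 2 (vec4 1 0 x y) (vec4 0 1 z w) \<longleftrightarrow>
      x = x * a * x + (z + x * b * z) \<and> 1 + z = z * a * x + z * b * z \<and> y = 0 \<and> w = 0"
    by (auto simp: M6_def ideal_conds)
  also have "\<dots> \<longleftrightarrow> x = -(z^2) \<and> y = 0 \<and> z \<in> V6_2 a b \<and> w = 0"
    unfolding V6_2_def mem_Collect_eq by algebra
  finally show ?thesis .
qed

lemma M6_cells:
  fixes x y z w a b :: "'k::field"
  shows
    "line_ideal (M6 a b) 3 (vec4 0 0 1 x) \<longleftrightarrow> a = 0 \<and> b = 0 \<and> x = 0"
    "\<not> line_ideal (M6 a b) 4 (vec4 0 0 0 1)"
    "\<not> plane_ideal (M6 a b) 1 3 (vec4 1 x 0 y) (vec4 0 0 1 z)"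
    "\<not> plane_ideal (M6 a b) 1 4 (vec4 1 x y 0) (vec4 0 0 0 1)"
    "plane_ideal (M6 a b) 2 3 (vec4 0 1 0 x) (vec4 0 0 1 y) \<longleftrightarrow> a = 0 \<and> x = 0 \<and> y = 0"
    "\<not> plane_ideal (M6 a b) 2 4 (vec4 0 1 x 0) (vec4 0 0 0 1)"
    "\<not> plane_ideal (M6 a b) 3 4 (vec4 0 0 1 0) (vec4 0 0 0 1)"
    "ker_ideal (M6 a b) (vec4 x y z w) \<longleftrightarrow> a * x = 0 \<and> y = 0 \<and> z = 0"
  by (auto simp: M6_def ideal_conds)

text \<open>As for M^6, with eigenvalue T = a y and characteristic polynomial T^3 - b T - a.\<close>

lemma M7_line_1:
  fixes x y z a b :: "'k::field"
  shows
    "line_ideal (M7 a b) 1 (vec4 1 x y z) \<longleftrightarrow> x = a * y^2 \<and> y \<in> V7_1 a b \<and> z = 0"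
proof -
  have "line_ideal (M7 a b) 1 (vec4 1 x y z) \<longleftrightarrow>
      1 + y * b = y * a * x \<and> x = y * a * y \<and> z = 0"
    by (auto simp: M7_def ideal_conds)
  also have "\<dots> \<longleftrightarrow> x = a * y^2 \<and> y \<in> V7_1 a b \<and> z = 0"
    unfolding V7_1_def mem_Collect_eq by algebra
  finally show ?thesis .
qed

lemma M7_line_2:
  fixes x y a b :: "'k::field"
  shows
    "line_ideal (M7 a b) 2 (vec4 0 1 x y) \<longleftrightarrow> a = 0 \<and> x \<in> V4 b \<and> y = 0"
proof -
  have "line_ideal (M7 a b) 2 (vec4 0 1 x y) \<longleftrightarrow>
      a = 0 \<and> x * b * x = 1 \<and> y = 0"
    by (auto simp: M7_def ideal_conds)
  also have "\<dots> \<longleftrightarrow> a = 0 \<and> x \<in> V4 b \<and> y = 0"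
    unfolding V4_def mem_Collect_eq by algebra
  finally show ?thesis .
qed

text \<open>Again the eigenvalue of the transpose is T = - 1 / z, now in T^3 - b T - a.\<close>

lemma M7_plane_12:
  fixes x y z w a b :: "'k::field"
  shows
    "plane_ideal (M7 a b) 1 2 (vec4 1 0 x y) (vec4 0 1 z w) \<longleftrightarrow>
      x = -(z^2) \<and> y = 0 \<and> z \<in> V7_2 a b \<and> w = 0"
proof -
  have "plane_ideal (M7 a b) 1 2 (vec4 1 0 x y) (vec4 0 1 z w) \<longleftrightarrow>
      x * a * x + (z + x * b * z) = 0 \<and> z * a * x + z * b * z = 1 \<and> y = 0 \<and> w = 0"
    by (auto simp: M7_def ideal_conds)
  also have "\<dots> \<longleftrightarrow> x = -(z^2) \<and> y = 0 \<and> z \<in> V7_2 a b \<and> w = 0"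
    unfolding V7_2_def mem_Collect_eq by algebra
  finally show ?thesis .
qed

lemma M7_cells:
  fixes x y z w a b :: "'k::field"
  shows
    "line_ideal (M7 a b) 3 (vec4 0 0 1 x) \<longleftrightarrow> a = 0 \<and> b = 0 \<and> x = 0"
    "\<not> line_ideal (M7 a b) 4 (vec4 0 0 0 1)"
    "\<not> plane_ideal (M7 a b) 1 3 (vec4 1 x 0 y) (vec4 0 0 1 z)"
    "\<not> plane_ideal (M7 a b) 1 4 (vec4 1 x y 0) (vec4 0 0 0 1)"
    "plane_ideal (M7 a b) 2 3 (vec4 0 1 0 x) (vec4 0 0 1 y) \<longleftrightarrow> a = 0 \<and> x = 0 \<and> y = 0"
    "\<not> plane_ideal (M7 a b) 2 4 (vec4 0 1 x 0) (vec4 0 0 0 1)"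
    "\<not> plane_ideal (M7 a b) 3 4 (vec4 0 0 1 0) (vec4 0 0 0 1)"
    "ker_ideal (M7 a b) (vec4 x y z w) \<longleftrightarrow> a * x = 0 \<and> y = 0 \<and> z = 0"
  by (auto simp: M7_def ideal_conds)

text \<open>M^8 is the product of two nonabelian algebras of dimension 2. The line ideals are the
  two derived lines, through e2 and e4; the plane ideals are the two factors and the derived
  algebra.\<close>

lemma M8_cells:
  fixes x y z w :: "'k::field"
  shows
    "\<not> line_ideal M8 1 (vec4 1 x y z)"
    "line_ideal M8 2 (vec4 0 1 x y) \<longleftrightarrow> x = 0 \<and> y = 0"
    "\<not> line_ideal M8 3 (vec4 0 0 1 x)"
    "line_ideal M8 4 (vec4 0 0 0 1)"
    "plane_ideal M8 1 2 (vec4 1 0 x y) (vec4 0 1 z w) \<longleftrightarrow> x = 0 \<and> y = 0 \<and> z = 0 \<and> w = 0"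
    "\<not> plane_ideal M8 1 3 (vec4 1 x 0 y) (vec4 0 0 1 z)"
    "\<not> plane_ideal M8 1 4 (vec4 1 x y 0) (vec4 0 0 0 1)"
    "\<not> plane_ideal M8 2 3 (vec4 0 1 0 x) (vec4 0 0 1 y)"
    "plane_ideal M8 2 4 (vec4 0 1 x 0) (vec4 0 0 0 1) \<longleftrightarrow> x = 0"
    "plane_ideal M8 3 4 (vec4 0 0 1 0) (vec4 0 0 0 1)"
    "ker_ideal M8 (vec4 x y z w) \<longleftrightarrow> y = 0 \<and> w = 0"
  by (auto simp: M8_def ideal_conds)

text \<open>The assumption says that e1 + r e2 is never an eigenvector of ad e4, whose
  characteristic polynomial on the span of e1 and e2 is T^2 - T - a. That span is therefore a
  minimal ideal, and every nonzero combination of ad e3 (the identity there) and ad e4 is invertible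
  on it, so every nonzero ideal contains it.\<close>

lemma M9_cells:
  fixes x y z w a :: "'k::field"
  assumes "\<And>r. a \<noteq> r + r * r"
  shows
    "\<not> line_ideal (M9 a) 1 (vec4 1 x y z)"
    "\<not> line_ideal (M9 a) 2 (vec4 0 1 x y)"
    "\<not> line_ideal (M9 a) 3 (vec4 0 0 1 x)"
    "\<not> line_ideal (M9 a) 4 (vec4 0 0 0 1)"
    "plane_ideal (M9 a) 1 2 (vec4 1 0 x y) (vec4 0 1 z w) \<longleftrightarrow> x = 0 \<and> y = 0 \<and> z = 0 \<and> w = 0"
    "\<not> plane_ideal (M9 a) 1 3 (vec4 1 x 0 y) (vec4 0 0 1 z)"
    "\<not> plane_ideal (M9 a) 1 4 (vec4 1 x y 0) (vec4 0 0 0 1)"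
    "\<not> plane_ideal (M9 a) 2 3 (vec4 0 1 0 x) (vec4 0 0 1 y)"
    "\<not> plane_ideal (M9 a) 2 4 (vec4 0 1 x 0) (vec4 0 0 0 1)"
    "\<not> plane_ideal (M9 a) 3 4 (vec4 0 0 1 0) (vec4 0 0 0 1)"
    "ker_ideal (M9 a) (vec4 x y z w) \<longleftrightarrow> x = 0 \<and> y = 0"
  using assms assms[of 0] by (auto simp: M9_def ideal_conds)

text \<open>Every nonzero ideal contains e2, and modulo e2 the map ad e4 is the identity on the span
  of e1 and e3. Each of the q + 1 lines of that span thus gives a plane ideal: q with pivots 1, 2
  and one with pivots 2, 3.\<close>

lemma M12_cells:
  fixes x y z w :: "'k::field"
  shows
    "\<not> line_ideal M12 1 (vec4 1 x y z)"
    "line_ideal M12 2 (vec4 0 1 x y) \<longleftrightarrow> x = 0 \<and> y = 0"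
    "\<not> line_ideal M12 3 (vec4 0 0 1 x)"
    "\<not> line_ideal M12 4 (vec4 0 0 0 1)"
    "plane_ideal M12 1 2 (vec4 1 0 x y) (vec4 0 1 z w) \<longleftrightarrow> y = 0 \<and> z = 0 \<and> w = 0"
    "\<not> plane_ideal M12 1 3 (vec4 1 x 0 y) (vec4 0 0 1 z)"
    "\<not> plane_ideal M12 1 4 (vec4 1 x y 0) (vec4 0 0 0 1)"
    "plane_ideal M12 2 3 (vec4 0 1 0 x) (vec4 0 0 1 y) \<longleftrightarrow> x = 0 \<and> y = 0"
    "\<not> plane_ideal M12 2 4 (vec4 0 1 x 0) (vec4 0 0 0 1)"
    "\<not> plane_ideal M12 3 4 (vec4 0 0 1 0) (vec4 0 0 0 1)"
    "ker_ideal M12 (vec4 x y z w) \<longleftrightarrow> x = 0 \<and> y = 0 \<and> z = 0"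
  by (auto simp: M12_def ideal_conds)

text \<open>Modulo e2 the vector e1 + x e3 must be an eigenvector of ad e4. The eigenvalue is 1 + x,
  and the coordinate at e3 gives a = x (1 + x).\<close>

lemma M13_plane_12:
  fixes x y z w a :: "'k::field"
  shows
    "plane_ideal (M13 a) 1 2 (vec4 1 0 x y) (vec4 0 1 z w) \<longleftrightarrow> x \<in> V13 a \<and> y = 0 \<and> z = 0 \<and> w = 0"
proof -
  have "plane_ideal (M13 a) 1 2 (vec4 1 0 x y) (vec4 0 1 z w) \<longleftrightarrow>
      a = x + x * x \<and> y = 0 \<and> z = 0 \<and> w = 0"
    by (auto simp: M13_def ideal_conds)
  also have "\<dots> \<longleftrightarrow> x \<in> V13 a \<and> y = 0 \<and> z = 0 \<and> w = 0"
    unfolding V13_def mem_Collect_eq by algebra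
  finally show ?thesis .
qed

lemma M13_cells:
  fixes x y z w a :: "'k::field"
  shows
    "\<not> line_ideal (M13 a) 1 (vec4 1 x y z)"
    "line_ideal (M13 a) 2 (vec4 0 1 x y) \<longleftrightarrow> x = 0 \<and> y = 0"
    "\<not> line_ideal (M13 a) 3 (vec4 0 0 1 x)"
    "\<not> line_ideal (M13 a) 4 (vec4 0 0 0 1)"
    "\<not> plane_ideal (M13 a) 1 3 (vec4 1 x 0 y) (vec4 0 0 1 z)"
    "\<not> plane_ideal (M13 a) 1 4 (vec4 1 x y 0) (vec4 0 0 0 1)"
    "\<not> plane_ideal (M13 a) 2 3 (vec4 0 1 0 x) (vec4 0 0 1 y)"
    "\<not> plane_ideal (M13 a) 2 4 (vec4 0 1 x 0) (vec4 0 0 0 1)"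
    "\<not> plane_ideal (M13 a) 3 4 (vec4 0 0 1 0) (vec4 0 0 0 1)"
    "ker_ideal (M13 a) (vec4 x y z w) \<longleftrightarrow> x = 0 \<and> y = 0 \<and> a * z = 0"
  by (auto simp: M13_def ideal_conds)

text \<open>The eigenvalue of e1 + x e3 modulo e2 is x itself.\<close>

lemma M14_plane_12:
  fixes x y z w a :: "'k::field"
  assumes "a \<noteq> 0"
  shows
    "plane_ideal (M14 a) 1 2 (vec4 1 0 x y) (vec4 0 1 z w) \<longleftrightarrow>
      x \<in> V14 a \<and> y = 0 \<and> z = 0 \<and> w = 0"
  using assms by (auto simp: M14_def ideal_conds V14_def power2_eq_square)

lemma M14_cells:
  fixes x y z w a :: "'k::field"
  assumes "a \<noteq> 0"
  shows
    "\<not> line_ideal (M14 a) 1 (vec4 1 x y z)"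
    "line_ideal (M14 a) 2 (vec4 0 1 x y) \<longleftrightarrow> x = 0 \<and> y = 0"
    "\<not> line_ideal (M14 a) 3 (vec4 0 0 1 x)"
    "\<not> line_ideal (M14 a) 4 (vec4 0 0 0 1)"
    "\<not> plane_ideal (M14 a) 1 3 (vec4 1 x 0 y) (vec4 0 0 1 z)"
    "\<not> plane_ideal (M14 a) 1 4 (vec4 1 x y 0) (vec4 0 0 0 1)"
    "\<not> plane_ideal (M14 a) 2 3 (vec4 0 1 0 x) (vec4 0 0 1 y)"
    "\<not> plane_ideal (M14 a) 2 4 (vec4 0 1 x 0) (vec4 0 0 0 1)"
    "\<not> plane_ideal (M14 a) 3 4 (vec4 0 0 1 0) (vec4 0 0 0 1)"
    "ker_ideal (M14 a) (vec4 x y z w) \<longleftrightarrow> x = 0 \<and> y = 0 \<and> z = 0"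
  using assms by (auto simp: M14_def ideal_conds)

subsection \<open>Numbers of ideals\<close>

text \<open>Peels off one coordinate of a tuple at a time, so that conditions on separate
  coordinates are counted by rewriting alone.\<close>

lemma card_Collect_case_prod:
  fixes P :: "'a::finite \<Rightarrow> 'b::finite \<Rightarrow> bool"
  shows "card (Collect (case_prod P)) = (\<Sum>x\<in>UNIV. card (Collect (P x)))"
proof -
  have "Collect (case_prod P) = (SIGMA x:UNIV. Collect (P x))" by auto
  then show ?thesis by simp
qed

lemma card_Collect_conj_const:
  "card {x. A \<and> P x} = (if A then card {x. P x} else 0)"
  "card {x. P x \<and> A} = (if A then card {x. P x} else 0)"
  "card {x::'a. A} = (if A then CARD('a) else 0)"
  by simp_all

lemma if_conj_zero: "(if A \<and> B then c else 0) = (if A then if B then c else 0 else (0::nat))"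
  by simp

lemma mult_if_zero: "c * (if A then b else 0) = (if A then c * b else (0::nat))"
  by simp

lemma card_if_empty: "card (if A then S else {}) = (if A then card S else 0)"
  by simp

lemma sum_if_const: "(\<Sum>x\<in>S. if A then f x else 0) = (if A then \<Sum>x\<in>S. f x else (0::nat))"
  by simp

lemma sum_if_card: "(\<Sum>x\<in>UNIV. if x \<in> V then c else 0) = card (V :: 'a::finite set) * (c::nat)"
  by (simp add: sum.If_cases)

text \<open>The rewrite rule \<open>if_if_eq_conj\<close> undoes \<open>if_conj_zero\<close> and has to be removed
  whenever \<open>count\<close> is used.\<close>

lemmas count = card_Collect_case_prod card_Collect_conj_const if_conj_zero mult_if_zero
  card_if_empty sum_if_const sum_if_card

text \<open>In these cells the leading entry is a function of a later one, so the conditions do not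
  separate by coordinates; the set is counted as the image of the free entry.\<close>

lemma card_graph:
  "card {(x, y, z). x = f y \<and> z = c} = CARD('a)"
  "card {(x, y, z). x = f y \<and> y \<in> V \<and> z = c} = card V"
  "card {(x, y, z, w). x = f z \<and> y = c \<and> z \<in> V \<and> w = d} = card V"
  for f :: "'a \<Rightarrow> 'b"
proof -
  have "{(x, y, z). x = f y \<and> z = c} = (\<lambda>y. (f y, y, c)) ` UNIV" by auto
  then show "card {(x, y, z). x = f y \<and> z = c} = CARD('a)"
    by (simp add: card_image inj_on_def)
  have "{(x, y, z). x = f y \<and> y \<in> V \<and> z = c} = (\<lambda>y. (f y, y, c)) ` V" by auto
  then show "card {(x, y, z). x = f y \<and> y \<in> V \<and> z = c} = card V"
    by (simp add: card_image inj_on_def)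
  have "{(x, y, z, w). x = f z \<and> y = c \<and> z \<in> V \<and> w = d} = (\<lambda>z. (f z, c, z, d)) ` V" by auto
  then show "card {(x, y, z, w). x = f z \<and> y = c \<and> z \<in> V \<and> w = d} = card V"
    by (simp add: card_image inj_on_def)
qed

lemma num_ideals_M1:
  defines "q \<equiv> CARD('k::{field,finite})"
  shows "num_ideals (M1 :: 'k ^ 4 \<Rightarrow> _) 1 = 1 + q + q^2 + q^3"
    "num_ideals (M1 :: 'k ^ 4 \<Rightarrow> _) 2 = (1 + q + q^2) * (1 + q^2)"
    "num_ideals (M1 :: 'k ^ 4 \<Rightarrow> _) 3 = 1 + q + q^2 + q^3"
  unfolding num_ideals_1[OF lie_algebra_M(1)] num_ideals_2[OF lie_algebra_M(1)]
    num_ideals_3[OF lie_algebra_M(1)] q_def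
  by (simp_all add: M1_def line_ideal_def plane_ideal_def ker_ideal_def bracket_of_def dot_zero
      count power2_eq_square power3_eq_cube algebra_simps del: if_if_eq_conj)

lemma num_ideals_M2:
  defines "q \<equiv> CARD('k::{field,finite})"
  shows
    "num_ideals (M2 :: 'k ^ 4 \<Rightarrow> _) 1 = 1"
    "num_ideals (M2 :: 'k ^ 4 \<Rightarrow> _) 2 = 1 + q + q^2"
    "num_ideals (M2 :: 'k ^ 4 \<Rightarrow> _) 3 = 1 + q + q^2"
  unfolding num_ideals_1[OF lie_algebra_M(2)] num_ideals_2[OF lie_algebra_M(2)]
    num_ideals_3[OF lie_algebra_M(2)] q_def
  by (simp_all add: M2_cells count power2_eq_square del: if_if_eq_conj)

text \<open>The roots - 1 and - 1 / a coincide for a = 1, and the second is absent for a =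
  0.\<close>

lemma card_M3_line_2:
  fixes a :: "'k::{field,finite}"
  shows "card {x. x = - 1 \<or> a * x = - 1} = (if a = 0 \<or> a = 1 then 1 else 2)"
proof (cases "a = 0")
  case False
  then have "{x. x = - 1 \<or> a * x = - 1} = {- 1, - (1 / a)}"
    by (auto simp: field_simps)
  then show ?thesis using False by (auto simp: card_insert_if field_simps)
qed simp

text \<open>A family of q planes with z = - 1, and one isolated plane with z = - 1 / a unless that
  value is missing or already in the family.\<close>

lemma card_M3_plane_12:
  fixes a :: "'k::{field,finite}"
  shows "card {(x :: 'k, y :: 'k, z, w :: 'k). y = 0 \<and> (z = - 1 \<or> a * z = - 1 \<and> x = 0) \<and> w = 0} =
    (if a = 0 \<or> a = 1 then CARD('k) else CARD('k) + 1)"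
proof -
  let ?S = "{(x :: 'k, y :: 'k, z, w :: 'k). y = 0 \<and> (z = - 1 \<or> a * z = - 1 \<and> x = 0) \<and> w = 0}"
  let ?L = "(\<lambda>x :: 'k. (x, 0 :: 'k, - 1 :: 'k, 0 :: 'k)) ` UNIV"
  have L: "card ?L = CARD('k)"
    by (intro card_image) (simp add: inj_on_def)
  show ?thesis
  proof (cases "a = 0 \<or> a = 1")
    case True
    then have "?S = ?L" by auto
    with True L show ?thesis by simp
  next
    case False
    then have "?S = insert (0, 0, - (1 / a), 0) ?L"
      by (auto simp: field_simps)
    moreover have "(0, 0, - (1 / a), 0) \<notin> ?L"
      using False by (auto simp: field_simps)
    ultimately show ?thesis using False L by simp
  qed
qed

lemma num_ideals_M3:
  fixes a :: "'k::{field,finite}"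
  defines "q \<equiv> CARD('k)"
  shows
    "num_ideals (M3 a) 1 = (if a = 0 then 1 + q else 1)"
    "num_ideals (M3 a) 2 = (if a = 1 then 1 + q else 2 + q)"
    "num_ideals (M3 a) 3 = (if a = 1 then 1 + q else 2 + q)"
  unfolding num_ideals_1[OF lie_algebra_M(3)] num_ideals_2[OF lie_algebra_M(3)]
    num_ideals_3[OF lie_algebra_M(3)] q_def M3_plane_12 card_M3_plane_12 M3_line_2
  by (auto simp: M3_cells card_M3_line_2 card_graph count simp del: if_if_eq_conj)

lemma num_ideals_M4:
  defines "q \<equiv> CARD('k::{field,finite})"
  shows
    "num_ideals (M4 :: 'k ^ 4 \<Rightarrow> _) 1 = 1 + q + q^2"
    "num_ideals (M4 :: 'k ^ 4 \<Rightarrow> _) 2 = 2 + q + q^2"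
    "num_ideals (M4 :: 'k ^ 4 \<Rightarrow> _) 3 = 2 + q"
  unfolding num_ideals_1[OF lie_algebra_M(4)] num_ideals_2[OF lie_algebra_M(4)]
    num_ideals_3[OF lie_algebra_M(4)] q_def
  by (simp_all add: M4_cells count power2_eq_square del: if_if_eq_conj)

lemma num_ideals_M5:
  defines "q \<equiv> CARD('k::{field,finite})"
  shows
    "num_ideals (M5 :: 'k ^ 4 \<Rightarrow> _) 1 = 1 + q + q^2"
    "num_ideals (M5 :: 'k ^ 4 \<Rightarrow> _) 2 = 1 + q + q^2"
    "num_ideals (M5 :: 'k ^ 4 \<Rightarrow> _) 3 = 1 + q"
  unfolding num_ideals_1[OF lie_algebra_M(5)] num_ideals_2[OF lie_algebra_M(5)]
    num_ideals_3[OF lie_algebra_M(5)] q_def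
  by (simp_all add: M5_cells count power2_eq_square del: if_if_eq_conj)

text \<open>The conditional summands come from the smaller cells: for a = 0 the span of e2 and e3 is
  a further plane ideal, \<open>V3 b\<close> counts the lines in it with pivot 2, and for b = 0 the
  line through e3 is one more.\<close>

lemma num_ideals_M6:
  fixes a b :: "'k::{field,finite}"
  defines "q \<equiv> CARD('k)"
  shows
    "num_ideals (M6 a b) 1 = (if a = 0 then 1 + q else 1)"
    "num_ideals (M6 a b) 2 = card (V6_2 a b) + (if a = 0 then 1 else 0)"
    "num_ideals (M6 a b) 3 = card (V6_1 a b) + (if a = 0 then card (V3 b) else 0)
      + (if a = 0 \<and> b = 0 then 1 else 0)"
  unfolding num_ideals_1[OF lie_algebra_M(6)] num_ideals_2[OF lie_algebra_M(6)]
    num_ideals_3[OF lie_algebra_M(6)] q_def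
  by (cases "a = 0"; cases "b = 0"; simp add: M6_cells M6_line_1 M6_line_2 M6_plane_12
      card_graph count del: if_if_eq_conj)+

lemma num_ideals_M7:
  fixes a b :: "'k::{field,finite}"
  defines "q \<equiv> CARD('k)"
  shows
    "num_ideals (M7 a b) 1 = (if a = 0 then 1 + q else 1)"
    "num_ideals (M7 a b) 2 = card (V7_2 a b) + (if a = 0 then 1 else 0)"
    "num_ideals (M7 a b) 3 = card (V7_1 a b) + (if a = 0 then card (V4 b) else 0)
      + (if a = 0 \<and> b = 0 then 1 else 0)"
  unfolding num_ideals_1[OF lie_algebra_M(7)] num_ideals_2[OF lie_algebra_M(7)]
    num_ideals_3[OF lie_algebra_M(7)] q_def
  by (cases "a = 0"; cases "b = 0"; simp add: M7_cells M7_line_1 M7_line_2 M7_plane_12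
      card_graph count del: if_if_eq_conj)+

lemma num_ideals_M8:
  defines "q \<equiv> CARD('k::{field,finite})"
  shows
    "num_ideals (M8 :: 'k ^ 4 \<Rightarrow> _) 1 = 1 + q"
    "num_ideals (M8 :: 'k ^ 4 \<Rightarrow> _) 2 = 3"
    "num_ideals (M8 :: 'k ^ 4 \<Rightarrow> _) 3 = 2"
  unfolding num_ideals_1[OF lie_algebra_M(8)] num_ideals_2[OF lie_algebra_M(8)]
    num_ideals_3[OF lie_algebra_M(8)] q_def
  by (simp_all add: M8_cells count del: if_if_eq_conj)

lemma num_ideals_M9:
  fixes a :: "'k::{field,finite}"
  defines "q \<equiv> CARD('k)"
  assumes "\<And>r. a \<noteq> r + r * r"
  shows
    "num_ideals (M9 a) 1 = 1 + q"
    "num_ideals (M9 a) 2 = 1"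
    "num_ideals (M9 a) 3 = 0"
  unfolding num_ideals_1[OF lie_algebra_M(9)] num_ideals_2[OF lie_algebra_M(9)]
    num_ideals_3[OF lie_algebra_M(9)] q_def
  by (simp_all add: M9_cells[OF assms(2)] count del: if_if_eq_conj)

lemma num_ideals_M12:
  defines "q \<equiv> CARD('k::{field,finite})"
  shows
    "num_ideals (M12 :: 'k ^ 4 \<Rightarrow> _) 1 = 1"
    "num_ideals (M12 :: 'k ^ 4 \<Rightarrow> _) 2 = 1 + q"
    "num_ideals (M12 :: 'k ^ 4 \<Rightarrow> _) 3 = 1"
  unfolding num_ideals_1[OF lie_algebra_M(10)] num_ideals_2[OF lie_algebra_M(10)]
    num_ideals_3[OF lie_algebra_M(10)] q_def
  by (simp_all add: M12_cells count del: if_if_eq_conj)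

lemma num_ideals_M13:
  fixes a :: "'k::{field,finite}"
  defines "q \<equiv> CARD('k)"
  shows
    "num_ideals (M13 a) 1 = (if a = 0 then 1 + q else 1)"
    "num_ideals (M13 a) 2 = card (V13 a)"
    "num_ideals (M13 a) 3 = 1"
  unfolding num_ideals_1[OF lie_algebra_M(11)] num_ideals_2[OF lie_algebra_M(11)]
    num_ideals_3[OF lie_algebra_M(11)] q_def
  by (simp_all add: M13_cells M13_plane_12 count del: if_if_eq_conj)

lemma num_ideals_M14:
  fixes a :: "'k::{field,finite}"
  defines "q \<equiv> CARD('k)"
  assumes "a \<noteq> 0"
  shows
    "num_ideals (M14 a) 1 = 1"
    "num_ideals (M14 a) 2 = card (V14 a)"
    "num_ideals (M14 a) 3 = 1"
  unfolding num_ideals_1[OF lie_algebra_M(12)] num_ideals_2[OF lie_algebra_M(12)]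
    num_ideals_3[OF lie_algebra_M(12)] q_def
  by (simp_all add: M14_cells[OF assms(2)] M14_plane_12[OF assms(2)] count del: if_if_eq_conj)

section \<open>Degenerate parameters and the zeta functions\<close>

lemma card_V_zero:
  fixes b :: "'k::{field,finite}"
  shows "card (V6_1 0 b) = (if b = 0 then 0 else 1)" "card (V7_1 0 b) = (if b = 0 then 0 else 1)"
    "card (V3 (0 :: 'k)) = 1" "card (V4 (0 :: 'k)) = 0" "card (V13 (0 :: 'k)) = 2"
proof -
  have root: "{x. b * x + 1 = 0} = (if b = 0 then {} else {- (1 / b)})"
    by (auto simp: field_simps eq_neg_iff_add_eq_0)
  have "V6_1 0 b = {x. b * x + 1 = 0}"
    by (simp add: V6_1_def)
  with root show "card (V6_1 0 b) = (if b = 0 then 0 else 1)" by simp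
  have "0^2 * x^3 - b * x - 1 = - (b * x + 1)" for x
    by simp
  then have "V7_1 0 b = {x. b * x + 1 = 0}"
    by (simp only: V7_1_def neg_equal_0_iff_equal)
  with root show "card (V7_1 0 b) = (if b = 0 then 0 else 1)" by simp
  have "V3 (0 :: 'k) = {- 1}"
    by (auto simp: V3_def) (metis minus_minus)
  then show "card (V3 (0 :: 'k)) = 1" by simp
  show "card (V4 (0 :: 'k)) = 0" by (simp add: V4_def)
  have "V13 (0 :: 'k) = {x. x * (x + 1) = 0}"
    by (simp add: V13_def power2_eq_square distrib_left)
  also have "\<dots> = {0, - 1}"
    by (auto simp: eq_neg_iff_add_eq_0)
  finally show "card (V13 (0 :: 'k)) = 2" by simp
qed

text \<open>For a = 0 the cubics drop to the quadratics that also count lines, which is why the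
  coefficients of t^2 and t^3 of M^6 and M^7 agree when a = 0 and b is nonzero.\<close>

lemma V_2_zero_left:
  fixes b :: "'k::field"
  shows "V6_2 0 b = V3 b" "V7_2 0 b = V4 b"
  unfolding V6_2_def V3_def V7_2_def V4_def set_eq_iff mem_Collect_eq
  by (intro allI; algebra)+

theorem theorem1p8:
  fixes a b :: "'k::{field,finite}" and s t :: complex and q :: nat
  assumes "q = CARD('k)" and "t = of_nat q powr (- s)" and "a \<noteq> 0" and "b \<noteq> 0"
  shows
    "ideal_zeta (M1 :: 'k ^ 4 \<Rightarrow> _) s =
       1 + of_nat (1 + q + q^2 + q^3) * t + of_nat ((1 + q + q^2) * (1 + q^2)) * t^2
         + of_nat (1 + q + q^2 + q^3) * t^3 + t^4
   \<and> ideal_zeta (M2 :: 'k ^ 4 \<Rightarrow> _) s =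
       1 + t + of_nat (1 + q + q^2) * t^2 + of_nat (1 + q + q^2) * t^3 + t^4
   \<and> (a \<noteq> 1 \<longrightarrow> ideal_zeta (M3 a) s =
       1 + t + of_nat (2 + q) * t^2 + of_nat (2 + q) * t^3 + t^4)
   \<and> ideal_zeta (M3 (1 :: 'k)) s =
       1 + t + of_nat (1 + q) * t^2 + of_nat (1 + q) * t^3 + t^4
   \<and> ideal_zeta (M3 (0 :: 'k)) s =
       1 + of_nat (1 + q) * t + of_nat (2 + q) * t^2 + of_nat (2 + q) * t^3 + t^4
   \<and> ideal_zeta (M4 :: 'k ^ 4 \<Rightarrow> _) s =
       1 + of_nat (1 + q + q^2) * t + of_nat (2 + q + q^2) * t^2 + of_nat (2 + q) * t^3 + t^4
   \<and> ideal_zeta (M5 :: 'k ^ 4 \<Rightarrow> _) s =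
       1 + of_nat (1 + q + q^2) * t + of_nat (1 + q + q^2) * t^2 + of_nat (1 + q) * t^3 + t^4
   \<and> ideal_zeta (M6 a b) s =
       1 + t + of_nat (card (V6_2 a b)) * t^2 + of_nat (card (V6_1 a b)) * t^3 + t^4
   \<and> ideal_zeta (M6 a 0) s =
       1 + t + of_nat (card (V6_2 a 0)) * t^2 + of_nat (card (V6_1 a 0)) * t^3 + t^4
   \<and> ideal_zeta (M6 0 b) s =
       1 + of_nat (1 + q) * t + of_nat (1 + card (V3 b)) * t^2
         + of_nat (1 + card (V3 b)) * t^3 + t^4
   \<and> ideal_zeta (M6 (0 :: 'k) 0) s =
       1 + of_nat (1 + q) * t + 2 * t^2 + 2 * t^3 + t^4
   \<and> ideal_zeta (M7 a b) s =
       1 + t + of_nat (card (V7_2 a b)) * t^2 + of_nat (card (V7_1 a b)) * t^3 + t^4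
   \<and> ideal_zeta (M7 a 0) s =
       1 + t + of_nat (card (V7_2 a 0)) * t^2 + of_nat (card (V7_1 a 0)) * t^3 + t^4
   \<and> ideal_zeta (M7 0 b) s =
       1 + of_nat (1 + q) * t + of_nat (1 + card (V4 b)) * t^2
         + of_nat (1 + card (V4 b)) * t^3 + t^4
   \<and> ideal_zeta (M7 (0 :: 'k) 0) s =
       1 + of_nat (1 + q) * t + t^2 + t^3 + t^4
   \<and> ideal_zeta (M8 :: 'k ^ 4 \<Rightarrow> _) s =
       1 + of_nat (1 + q) * t + 3 * t^2 + 2 * t^3 + t^4
   \<and> ((\<nexists>x. x^2 - x - a = 0) \<longrightarrow> ideal_zeta (M9 a) s =
       1 + of_nat (1 + q) * t + t^2 + t^4)
   \<and> ideal_zeta (M12 :: 'k ^ 4 \<Rightarrow> _) s =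
       1 + t + of_nat (1 + q) * t^2 + t^3 + t^4
   \<and> ideal_zeta (M13 a) s =
       1 + t + of_nat (card (V13 a)) * t^2 + t^3 + t^4
   \<and> ideal_zeta (M13 (0 :: 'k)) s =
       1 + of_nat (1 + q) * t + 2 * t^2 + t^3 + t^4
   \<and> ideal_zeta (M14 a) s =
       1 + t + of_nat (card (V14 a)) * t^2 + t^3 + t^4"
proof -
  have t: "t = of_nat CARD('k) powr (- s)" using assms(1,2) by simp
  note zeta = lie_algebra_M[THEN ideal_zeta_eq, OF t]
  note nums = num_ideals_M1 num_ideals_M2 num_ideals_M3 num_ideals_M4 num_ideals_M5 num_ideals_M6
    num_ideals_M7 num_ideals_M8 num_ideals_M12 num_ideals_M13 num_ideals_M14[OF assms(3)]
  have M9: "ideal_zeta (M9 a) s = 1 + of_nat (1 + q) * t + t^2 + t^4"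
    if nr: "\<nexists>x. x^2 - x - a = 0"
  proof -
    have "a \<noteq> r + r * r" for r
    proof
      assume "a = r + r * r"
      \<comment> \<open>The cell computation parametrises roots of x^2 - x - a by r = - x.\<close>
      then have "(- r)^2 - (- r) - a = 0" by (simp add: power2_eq_square)
      with nr show False by blast
    qed
    from num_ideals_M9[OF this] show ?thesis by (simp add: zeta assms(1) del: One_nat_def)
  qed
  show ?thesis
    using assms(3,4) M9 by (simp add: zeta nums card_V_zero V_2_zero_left assms(1) del: One_nat_def)
qed

end
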